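(* Let $H = T \cup C$ be a complete Halin graph with characteristic tree $T$ and adjoint cycle $C$, and suppose $|C| \neq 5$. Then \[ \mathrm{ch}'_{\mathrm{star}}(H) \leq \max\left\{ \left\lfloor \frac{\theta(T) + \Delta(T)}{2} \right\rfloor,\ 2\left\lfloor \frac{\Delta(T)}{2} \right\rfloor + 6 \right\}, \] where $\theta(T) = \max_{xy \in E(T)} \{ d_T(x) + d_T(y) \}$.
   Context: All graphs are finite and simple. A star $k$-edge coloring of a graph $G$ is a proper edge coloring $\phi: E(G) \to \{1,\dots,k\}$ such that no path or cycle of length four (i.e. with four edges) in $G$ is bichromatic. Given a list assignment $L$ assigning a finite set $L(e)$ to each edge $e$, $G$ is star $k$-edge choosable if for every $L$ with $|L(e)| \geq k$ for all $e$ there is a star edge coloring $\varphi$ with $\varphi(e) \in L(e)$ for all $e$. The list star chromatic index $\mathrm{ch}'_{\mathrm{star}}(G)$ is the minimum such $k$. A Halin graph $H = T \cup C$ is a plane graph consisting of a plane embedding of a tree $T$ (the characteristic tree) having no vertices of degree $2$, together with a cycle $C$ (the adjoint cycle) connecting all the leaves of $T$ such that $C$ is the boundary of the exterior face. A Halin graph is complete if $T$ has a root vertex $r$ such that all leaves of $T$ are at the same distance from $r$ in $T$. $|C|$ denotes the length of $C$, and $d_T(x)$ the degree of $x$ in $T$. *)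

theory Defs
  imports "HOL-Analysis.Analysis"
begin

section \<open>Finite simple graphs\<close>

record 'a ugraph =
  verts :: "'a set"
  edges :: "'a set set"

definition simple_graph :: "'a ugraph \<Rightarrow> bool" where
  "simple_graph G \<longleftrightarrow> finite (verts G) \<and> (\<forall>e\<in>edges G. e \<subseteq> verts G \<and> card e = 2)"

definition deg :: "'a ugraph \<Rightarrow> 'a \<Rightarrow> nat" where
  "deg G v = card {e \<in> edges G. v \<in> e}"

definition max_deg :: "'a ugraph \<Rightarrow> nat" where
  "max_deg G = Max (deg G ` verts G)"

definition theta :: "'a ugraph \<Rightarrow> nat" where
  "theta G = Max {deg G x + deg G y | x y. {x, y} \<in> edges G}"

definition leaves :: "'a ugraph \<Rightarrow> 'a set" where
  "leaves G = {v \<in> verts G. deg G v = 1}"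

text \<open>Paths and cycles are given by their lists of distinct vertices; a list of \<open>n\<close> vertices
  describes a path with \<open>n - 1\<close> edges or a cycle with \<open>n\<close> edges.\<close>

definition path_edges :: "'a list \<Rightarrow> 'a set set" where
  "path_edges p = {{p ! i, p ! Suc i} | i. Suc i < length p}"

definition cycle_edges :: "'a list \<Rightarrow> 'a set set" where
  "cycle_edges p = insert {last p, hd p} (path_edges p)"

definition path_in :: "'a ugraph \<Rightarrow> 'a list \<Rightarrow> bool" where
  "path_in G p \<longleftrightarrow> p \<noteq> [] \<and> distinct p \<and> set p \<subseteq> verts G \<and> path_edges p \<subseteq> edges G"

definition cycle_in :: "'a ugraph \<Rightarrow> 'a list \<Rightarrow> bool" where
  "cycle_in G p \<longleftrightarrow> length p \<ge> 3 \<and> distinct p \<and> set p \<subseteq> verts G \<and> cycle_edges p \<subseteq> edges G"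

definition connected_graph :: "'a ugraph \<Rightarrow> bool" where
  "connected_graph G \<longleftrightarrow> verts G \<noteq> {} \<and>
     (\<forall>u\<in>verts G. \<forall>v\<in>verts G. \<exists>p. path_in G p \<and> hd p = u \<and> last p = v)"

definition tree :: "'a ugraph \<Rightarrow> bool" where
  "tree G \<longleftrightarrow> simple_graph G \<and> connected_graph G \<and> \<not> (\<exists>p. cycle_in G p)"

definition cycle_graph :: "'a ugraph \<Rightarrow> bool" where
  "cycle_graph G \<longleftrightarrow> (\<exists>p. cycle_in G p \<and> verts G = set p \<and> edges G = cycle_edges p)"

definition graph_dist :: "'a ugraph \<Rightarrow> 'a \<Rightarrow> 'a \<Rightarrow> nat" where
  "graph_dist G u v =
     (LEAST n. \<exists>p. path_in G p \<and> hd p = u \<and> last p = v \<and> length p = Suc n)"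

definition graph_union :: "'a ugraph \<Rightarrow> 'a ugraph \<Rightarrow> 'a ugraph" where
  "graph_union G K = \<lparr>verts = verts G \<union> verts K, edges = edges G \<union> edges K\<rparr>"


section \<open>List star edge coloring\<close>

definition proper_edge_coloring :: "'a ugraph \<Rightarrow> ('a set \<Rightarrow> nat) \<Rightarrow> bool" where
  "proper_edge_coloring G \<phi> \<longleftrightarrow>
     (\<forall>e\<in>edges G. \<forall>f\<in>edges G. e \<noteq> f \<and> e \<inter> f \<noteq> {} \<longrightarrow> \<phi> e \<noteq> \<phi> f)"

definition star_edge_coloring :: "'a ugraph \<Rightarrow> ('a set \<Rightarrow> nat) \<Rightarrow> bool" where
  "star_edge_coloring G \<phi> \<longleftrightarrow> proper_edge_coloring G \<phi> \<and>
     \<not> (\<exists>p. path_in G p \<and> length p = 5 \<and> card (\<phi> ` path_edges p) = 2) \<and>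
     \<not> (\<exists>p. cycle_in G p \<and> length p = 4 \<and> card (\<phi> ` cycle_edges p) = 2)"

definition star_edge_choosable :: "'a ugraph \<Rightarrow> nat \<Rightarrow> bool" where
  "star_edge_choosable G k \<longleftrightarrow>
     (\<forall>L. (\<forall>e\<in>edges G. finite (L e) \<and> card (L e) \<ge> k) \<longrightarrow>
          (\<exists>\<phi>. star_edge_coloring G \<phi> \<and> (\<forall>e\<in>edges G. \<phi> e \<in> L e)))"

definition list_star_chromatic_index :: "'a ugraph \<Rightarrow> nat" where
  "list_star_chromatic_index G = (LEAST k. star_edge_choosable G k)"


section \<open>Plane graphs and Halin graphs\<close>

text \<open>A plane embedding sends each vertex \<open>v\<close> to the point \<open>pos v\<close> and each edge \<open>e\<close> to the
  arc \<open>\<gamma> e\<close>; the interior of an arc contains no vertex and no point of another arc.\<close>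

definition plane_embedding ::
    "'a ugraph \<Rightarrow> ('a \<Rightarrow> complex) \<Rightarrow> ('a set \<Rightarrow> real \<Rightarrow> complex) \<Rightarrow> bool" where
  "plane_embedding G pos \<gamma> \<longleftrightarrow> inj_on pos (verts G) \<and>
     (\<forall>e\<in>edges G. arc (\<gamma> e) \<and> {pathstart (\<gamma> e), pathfinish (\<gamma> e)} = pos ` e \<and>
                   path_image (\<gamma> e) \<inter> pos ` verts G = pos ` e) \<and>
     (\<forall>e\<in>edges G. \<forall>f\<in>edges G. e \<noteq> f \<longrightarrow>
                   path_image (\<gamma> e) \<inter> path_image (\<gamma> f) = pos ` (e \<inter> f))"

definition drawing ::
    "('a \<Rightarrow> complex) \<Rightarrow> ('a set \<Rightarrow> real \<Rightarrow> complex) \<Rightarrow> 'a ugraph \<Rightarrow> complex set" where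
  "drawing pos \<gamma> G = pos ` verts G \<union> (\<Union>e\<in>edges G. path_image (\<gamma> e))"

text \<open>The drawing of a finite graph is compact, so its \<open>outside\<close> is the unique unbounded
  component of the complement, that is, the exterior face.\<close>

definition halin_graph :: "'a ugraph \<Rightarrow> 'a ugraph \<Rightarrow> 'a ugraph \<Rightarrow> bool" where
  "halin_graph H T C \<longleftrightarrow>
     tree T \<and> (\<forall>v\<in>verts T. deg T v \<noteq> 2) \<and>
     cycle_graph C \<and> verts C = leaves T \<and>
     simple_graph H \<and> H = graph_union T C \<and>
     (\<exists>pos \<gamma>. plane_embedding H pos \<gamma> \<and>
              frontier (outside (drawing pos \<gamma> H)) = drawing pos \<gamma> C)"

definition complete_halin_graph :: "'a ugraph \<Rightarrow> 'a ugraph \<Rightarrow> 'a ugraph \<Rightarrow> bool" where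
  "complete_halin_graph H T C \<longleftrightarrow> halin_graph H T C \<and>
     (\<exists>r\<in>verts T. \<exists>d. \<forall>v\<in>leaves T. graph_dist T r v = d)"

end

theory Submission
  imports Defs
begin

text \<open>All edges are colored greedily with respect to a fixed conflict relation. Orient a regular
  tournament on the children of every vertex \<open>u\<close>: an edge below the child \<open>v\<close> may reuse the color of
  the edge from \<open>u\<close> to \<open>w\<close> only if \<open>v\<close> beats \<open>w\<close>, so it has to avoid about half of the colors at
  \<open>u\<close> only. If the number of children is even, half of them (the set \<open>B\<close>) lose one match too many;
  they may in exchange reuse the color of the edge above \<open>u\<close>, for which their own upper edges avoid
  all colors at the parent of \<open>u\<close>.

  By planarity, the leaves with a common parent form an interval of \<open>C\<close>, and it has length at
  least two. An edge of \<open>C\<close> inside an interval avoids all colors of tree edges at the common parent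
  and at most four further colors. An edge of \<open>C\<close> between two intervals has to avoid at most seven
  colors, or nine if one of the two parents has degree at least four. The leaves at the ends of
  intervals are colored before the other leaves, which makes the colors of the tree edges at two
  consecutive leaves different.\<close>

section \<open>Greedy colorings and tournaments\<close>

text \<open>A bichromatic walk needs two equalities of colors at once, whereas a greedy step can
  only enforce single inequalities. So it has to be settled in advance, independently of the lists,
  which of the two equalities will fail. For walks that turn at a vertex \<open>u\<close> with two
  edges on either side, the tournament at \<open>u\<close> settles it; for walks with three
  consecutive descending edges, membership in \<open>B\<close> does. The bound
  \<open>(theta T + max_deg T) div 2\<close> comes from a tree edge whose upper end \<open>v\<close>
  has degree \<open>a\<close>, where the parent \<open>u\<close> of \<open>v\<close> has degree
  \<open>b\<close>: the edges at \<open>v\<close> and half of the edges at \<open>u\<close> amount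
  to \<open>a + b/2 = ((a + b) + a)/2\<close>. For edges in \<open>B\<close> the halving is
  exchanged, which gives \<open>b + a/2\<close>. The rounding down is the obstacle: with an even
  number of children below a vertex other than the root, a vertex that loses one match too many
  would cost one color more, and the set \<open>B\<close> saves exactly this color. The other bound
  is at least \<open>max_deg T + 5\<close> for either parity and leaves the room that the cycle
  edges need.\<close>

lemma greedy_list_coloring:
  fixes key :: "'b \<Rightarrow> nat" and L :: "'b \<Rightarrow> 'c set"
  assumes "finite X"
    and sym: "\<And>x y. R x y \<Longrightarrow> R y x" and irrefl: "\<And>x. \<not> R x x"
    and "\<And>x. x \<in> X \<Longrightarrow> card {y \<in> X. R x y \<and> key y \<le> key x} < card (L x)"
  shows "\<exists>g. (\<forall>x\<in>X. g x \<in> L x) \<and> (\<forall>x\<in>X. \<forall>y\<in>X. R x y \<longrightarrow> g x \<noteq> g y)"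
  using assms(1,4)
proof (induction "card X" arbitrary: X)
  case 0
  then show ?case by simp
next
  case (Suc n)
  \<comment> \<open>An element of largest key is colored last. All its neighbors have a key at most
    as large, so the assumption counts every one of them. Ties are counted from both sides and may
    therefore be broken in any way.\<close>
  then have "X \<noteq> {}" by auto
  then have "Max (key ` X) \<in> key ` X" using Suc.prems(1) by (intro Max_in) auto
  then obtain m where m: "m \<in> X" "key m = Max (key ` X)" by auto
  then have max: "key y \<le> key m" if "y \<in> X" for y using that Suc.prems(1) by auto
  let ?Y = "X - {m}"
  have "card {y \<in> ?Y. R x y \<and> key y \<le> key x} < card (L x)" if "x \<in> ?Y" for x
  proof -
    have "card {y \<in> ?Y. R x y \<and> key y \<le> key x} \<le> card {y \<in> X. R x y \<and> key y \<le> key x}"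
      by (rule card_mono) (use Suc.prems(1) in auto)
    then show ?thesis using Suc.prems(2)[of x] that by simp
  qed
  moreover have "n = card ?Y" "finite ?Y" using Suc.hyps(2) m Suc.prems(1) by auto
  ultimately obtain g where g: "\<forall>x\<in>?Y. g x \<in> L x" "\<forall>x\<in>?Y. \<forall>y\<in>?Y. R x y \<longrightarrow> g x \<noteq> g y"
    using Suc.hyps(1)[of ?Y] by blast
  let ?N = "{y \<in> X. R m y \<and> key y \<le> key m}"
  have "card (g ` ?N) < card (L m)"
    using card_image_le[of ?N g] Suc.prems(1) Suc.prems(2)[OF m(1)] by simp
  then obtain c where c: "c \<in> L m" "c \<notin> g ` ?N"
    using Suc.prems(1) card_mono[of "g ` ?N" "L m"] by (auto simp: not_le[symmetric])
  have "c \<noteq> g y" if "y \<in> X" "R m y" for y using c(2) that max by auto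
  moreover have "R x m \<longleftrightarrow> R m x" for x using sym by blast
  ultimately show ?case
    by (intro exI[of _ "g(m := c)"]) (use g c(1) irrefl in \<open>auto simp: m(1)\<close>)
qed

text \<open>The average out-degree is \<open>(card S - 1) / 2\<close>, so
  \<open>card S div 2\<close> wins for everyone are possible only if \<open>card S\<close> is odd;
  \<open>B\<close> collects the vertices that are one win short. The induction adds two vertices at
  a time: each old vertex beats exactly one of them and so keeps pace with
  \<open>card S div 2\<close>.\<close>

lemma balanced_tournament:
  assumes "finite S"
  shows "\<exists>R B. (\<forall>x\<in>S. \<forall>y\<in>S. \<not> (R x y \<and> R y x)) \<and> B \<subseteq> S \<and> card B \<le> card S div 2 \<and>
     (odd (card S) \<longrightarrow> B = {}) \<and>
     (\<forall>x\<in>S. card S div 2 \<le> card {y \<in> S. y \<noteq> x \<and> R x y} + of_bool (x \<in> B))"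
  using assms
proof (induction "card S" arbitrary: S rule: less_induct)
  case less
  show ?case
  proof (cases "card S < 2")
    case True
    then show ?thesis by (intro exI[of _ "\<lambda>_ _. False"] exI[of _ "{}"]) auto
  next
    case False
    then obtain a b S' where S: "S = insert a (insert b S')" and ab: "a \<noteq> b" "a \<notin> S'" "b \<notin> S'"
    proof -
      obtain a where a: "a \<in> S" using False by fastforce
      then have "card (S - {a}) > 0" using False less.prems by simp
      then obtain b where "b \<in> S - {a}" by (metis card.empty ex_in_conv less_irrefl)
      then show ?thesis using that[of a b "S - {a} - {b}"] a by auto
    qed
    have fin: "finite S'" using less.prems S by auto
    have cS: "card S = card S' + 2" using S ab fin by simp
    then obtain R B where R: "\<forall>x\<in>S'. \<forall>y\<in>S'. \<not> (R x y \<and> R y x)" and B: "B \<subseteq> S'"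
      "card B \<le> card S' div 2" "odd (card S') \<longrightarrow> B = {}"
      and out: "\<forall>x\<in>S'. card S' div 2 \<le> card {y \<in> S'. y \<noteq> x \<and> R x y} + of_bool (x \<in> B)"
      using less.hyps[of S'] fin by auto
    \<comment> \<open>\<open>a\<close> will beat \<open>b\<close> and \<open>H\<close>, and
      \<open>b\<close> will beat the rest of \<open>S'\<close>. As \<open>H\<close> is the smaller
      half, only \<open>b\<close> can fall short, and it does so exactly when \<open>card S\<close>
      is even.\<close>
    obtain H where H: "H \<subseteq> S'" "card H = card S' div 2"
      by (meson div_le_dividend obtain_subset_with_card_n)
    have finH: "finite H" using H fin finite_subset by blast
    define Q where "Q x y = (if x \<in> S' \<and> y \<in> S' then R x y
        else x = a \<and> y \<in> insert b H \<or> x = b \<and> y \<in> S' - H \<or> y = b \<and> x \<in> H \<or> y = a \<and> x \<in> S' - H)"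
      for x y
    define B' where "B' = (if even (card S) then insert b B else B)"
    have "\<not> (Q x y \<and> Q y x)" if "x \<in> S" "y \<in> S" for x y
      using that R H ab unfolding Q_def S by auto
    moreover have "B' \<subseteq> S" using B S unfolding B'_def by auto
    moreover have "card B' \<le> card S div 2"
      using B ab cS unfolding B'_def by (auto simp: card_insert_if finite_subset[OF B(1) fin])
    moreover have "odd (card S) \<longrightarrow> B' = {}" using B cS unfolding B'_def by auto
    moreover have "card S div 2 \<le> card {y \<in> S. y \<noteq> x \<and> Q x y} + of_bool (x \<in> B')" if xS: "x \<in> S" for x
    proof -
      consider "x \<in> S'" | "x = a" | "x = b" using xS S by auto
      then show ?thesis
      proof cases
        case 1
        let ?z = "if x \<in> H then b else a"
        have "{y \<in> S. y \<noteq> x \<and> Q x y} = insert ?z {y \<in> S'. y \<noteq> x \<and> R x y}"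
          using 1 ab H unfolding Q_def S by auto
        moreover have "?z \<notin> S'" using ab by auto
        ultimately have "card {y \<in> S. y \<noteq> x \<and> Q x y} = Suc (card {y \<in> S'. y \<noteq> x \<and> R x y})"
          using fin by simp
        then show ?thesis using out 1 cS ab unfolding B'_def by auto
      next
        case 2
        have "{y \<in> S. y \<noteq> x \<and> Q x y} = insert b H"
          using 2 ab H unfolding Q_def S by auto
        moreover have "b \<notin> H" using H ab by auto
        ultimately show ?thesis using H finH cS by simp
      next
        case 3
        have "{y \<in> S. y \<noteq> x \<and> Q x y} = S' - H"
          using 3 ab H unfolding Q_def S by auto
        then have "card {y \<in> S. y \<noteq> x \<and> Q x y} = card S' - card S' div 2"
          using H finH by (simp add: card_Diff_subset)
        moreover have "card S' div 2 + of_bool (odd (card S')) \<le> card S' - card S' div 2"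
          by (cases "odd (card S')") (auto elim!: oddE)
        ultimately show ?thesis using cS 3 unfolding B'_def by (cases "odd (card S')") auto
      qed
    qed
    ultimately show ?thesis by (intro exI[of _ Q] exI[of _ B']) blast
  qed
qed

text \<open>Meant for the colors \<open>c\<close> that an edge below a child \<open>v\<close> of
  \<open>u\<close> avoids above itself: \<open>u\<close> has \<open>m\<close> children and degree
  \<open>i\<close>, \<open>v\<close> beats \<open>w\<close> siblings and fails to beat
  \<open>n\<close>, \<open>p\<close> says that \<open>u\<close> has an upper edge, and
  \<open>q\<close> that \<open>v\<close> is in \<open>B\<close>. For \<open>q\<close> the missing
  win is made up for by the upper edge of \<open>u\<close>, which may be reused.\<close>

lemma tournament_degree_bound:
  fixes m w n i c :: nat
  assumes "c \<le> 1 + n + of_bool (p \<and> \<not> q)" "q \<longrightarrow> even m" "m = Suc (w + n)"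
    "m div 2 \<le> w + of_bool q" "i = m + of_bool p"
  shows "c \<le> i div 2 + 1"
  using assms by (cases p; cases q) simp_all

section \<open>Coloring a rooted tree with a cycle through its leaves\<close>

text \<open>What the coloring needs to know of a complete Halin graph. Planarity survives only in
  the last three assumptions about the blocks of leaves with a common parent, and completeness in
  \<open>S_sibling\<close> and \<open>S_dep\<close>.\<close>

locale rooted_tree_cycle =
  fixes V :: "'a set" and r :: 'a and par :: "'a \<Rightarrow> 'a" and dep :: "'a \<Rightarrow> nat"
    and S :: "'a set" and nx :: "'a \<Rightarrow> 'a"
  assumes finite_V: "finite V"
    and par_in: "x \<in> V - {r} \<Longrightarrow> par x \<in> V"
    and dep_root: "dep r = 0"
    and dep_par: "x \<in> V - {r} \<Longrightarrow> dep x = Suc (dep (par x))"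
    and S_subset: "S \<subseteq> V - {r}"
    and S_childless: "x \<in> S \<Longrightarrow> y \<in> V - {r} \<Longrightarrow> par y \<noteq> x"
    and S_sibling: "x \<in> S \<Longrightarrow> y \<in> V - {r} \<Longrightarrow> par y = par x \<Longrightarrow> y \<in> S"
    and S_dep: "x \<in> S \<Longrightarrow> y \<in> S \<Longrightarrow> dep x = dep y"
    and nx_bij: "bij_betw nx S S"
    and nx_neq: "x \<in> S \<Longrightarrow> nx x \<noteq> x"
    and nx_nx_neq: "x \<in> S \<Longrightarrow> nx (nx x) \<noteq> x"
    and exit_unique: "\<lbrakk>x \<in> S; y \<in> S; par (nx x) \<noteq> par x; par (nx y) \<noteq> par y; par x = par y\<rbrakk> \<Longrightarrow> x = y"
    and entry_unique: "\<lbrakk>x \<in> S; y \<in> S; par (nx x) \<noteq> par x; par (nx y) \<noteq> par y; par (nx x) = par (nx y)\<rbrakk>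
      \<Longrightarrow> x = y"
    and no_singleton_block: "\<lbrakk>x \<in> S; par (nx x) \<noteq> par x\<rbrakk> \<Longrightarrow> par (nx (nx x)) = par (nx x)"
begin

text \<open>An edge of the tree is named by its lower end, an edge of the cycle by its first end.
  Then \<open>Inc v\<close> names the edges of the tree at \<open>v\<close>, and \<open>jump x\<close> says that the cycle edge \<open>x\<close> joins
  leaves with different parents.\<close>

definition ch :: "'a \<Rightarrow> 'a set" where "ch v = {x \<in> V - {r}. par x = v}"

definition Inc :: "'a \<Rightarrow> 'a set" where "Inc v = ch v \<union> ({v} - {r})"

definition jump :: "'a \<Rightarrow> bool" where "jump x \<longleftrightarrow> par (nx x) \<noteq> par x"

definition pv :: "'a \<Rightarrow> 'a" where "pv = inv_into S nx"

lemma finite_ch [simp]: "finite (ch v)" using finite_V by (simp add: ch_def)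

lemma finite_Inc [simp]: "finite (Inc v)" by (simp add: Inc_def)

lemma finite_S: "finite S" using finite_V S_subset finite_subset by blast

lemma self_notin_ch: "v \<notin> ch v" using dep_par by (fastforce simp: ch_def)

lemma card_Inc: "card (Inc v) = card (ch v) + of_bool (v \<noteq> r)"
  using self_notin_ch[of v] by (simp add: Inc_def)

lemma nx_in [simp]: "x \<in> S \<Longrightarrow> nx x \<in> S" using nx_bij by (auto simp: bij_betw_def)

lemma pv_in [simp]: "x \<in> S \<Longrightarrow> pv x \<in> S"
  using nx_bij inv_into_into[of x nx S] by (auto simp: bij_betw_def pv_def)

lemma nx_pv [simp]: "x \<in> S \<Longrightarrow> nx (pv x) = x"
  using nx_bij f_inv_into_f[of x nx S] by (auto simp: bij_betw_def pv_def)

lemma pv_nx [simp]: "x \<in> S \<Longrightarrow> pv (nx x) = x"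
  using nx_bij inv_into_f_f[of nx S x] by (auto simp: bij_betw_def pv_def)

lemma jump_nx: "x \<in> S \<Longrightarrow> jump x \<Longrightarrow> \<not> jump (nx x)"
  using no_singleton_block by (auto simp: jump_def)

lemma jump_pv: "x \<in> S \<Longrightarrow> jump x \<Longrightarrow> \<not> jump (pv x)"
  using jump_nx[of "pv x"] by auto

lemma par_dep_eq: "x \<in> S \<Longrightarrow> y \<in> S \<Longrightarrow> dep (par x) = dep (par y)"
  using S_dep[of x y] dep_par S_subset by (metis nat.inject subsetD)

text \<open>Parents of leaves all have the same depth, so if one of the two parents were the root,
  the other would be the root too. Hence both ends of a jump have a tree edge above their parent,
  which later counts towards the degree of that parent.\<close>

lemma jump_par_not_root:
  assumes "x \<in> S" "jump x"
  shows "par x \<noteq> r" "par (nx x) \<noteq> r"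
proof -
  have iff: "y = r \<longleftrightarrow> dep y = 0" if "y \<in> V" for y using that dep_par[of y] dep_root by (cases "y = r") auto
  have "par x \<in> V" "par (nx x) \<in> V" using assms par_in S_subset nx_in by blast+
  then have "par x = r \<longleftrightarrow> par (nx x) = r"
    using iff par_dep_eq[of x "nx x"] assms by simp
  then show "par x \<noteq> r" "par (nx x) \<noteq> r" using assms(2) unfolding jump_def by metis+
qed

text \<open>Different vertices have disjoint sets of children, so the tournaments and exceptional
  sets chosen at single vertices merge into one relation and one set for the whole tree.\<close>

lemma tournament:
  obtains beat B where
    "\<And>x y. x \<in> V - {r} \<Longrightarrow> y \<in> V - {r} \<Longrightarrow> par x = par y \<Longrightarrow> \<not> (beat x y \<and> beat y x)"
    "\<And>v. card {x \<in> ch v. x \<in> B} \<le> card (ch v) div 2"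
    "\<And>v. odd (card (ch v)) \<Longrightarrow> ch v \<inter> B = {}"
    "\<And>x. x \<in> V - {r} \<Longrightarrow> card (ch (par x)) div 2
        \<le> card {y \<in> ch (par x). y \<noteq> x \<and> beat x y} + of_bool (x \<in> B)"
proof -
  have "\<forall>v. \<exists>R B. (\<forall>x\<in>ch v. \<forall>y\<in>ch v. \<not> (R x y \<and> R y x)) \<and> B \<subseteq> ch v \<and>
     card (B) \<le> card (ch v) div 2 \<and> (odd (card (ch v)) \<longrightarrow> B = {}) \<and>
     (\<forall>x\<in>ch v. card (ch v) div 2 \<le> card {y \<in> ch v. y \<noteq> x \<and> R x y} + of_bool (x \<in> B))"
    by (intro allI balanced_tournament finite_ch)
  from this[unfolded choice_iff] obtain Rf Bf where *: "\<And>v. (\<forall>x\<in>ch v. \<forall>y\<in>ch v. \<not> (Rf v x y \<and> Rf v y x)) \<and> Bf v \<subseteq> ch v \<and>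
     card (Bf v) \<le> card (ch v) div 2 \<and> (odd (card (ch v)) \<longrightarrow> Bf v = {}) \<and>
     (\<forall>x\<in>ch v. card (ch v) div 2 \<le> card {y \<in> ch v. y \<noteq> x \<and> Rf v x y} + of_bool (x \<in> Bf v))"
    by blast
  define beat where "beat x y = Rf (par x) x y" for x y
  define B where "B = {x. x \<in> Bf (par x)}"
  have B: "{x \<in> ch v. x \<in> B} = Bf v" for v using *[of v] by (auto simp: ch_def B_def)
  have mem: "x \<in> ch (par x)" if "x \<in> V - {r}" for x using that by (simp add: ch_def)
  have "\<not> (beat x y \<and> beat y x)" if "x \<in> V - {r}" "y \<in> V - {r}" "par x = par y" for x y
    using *[of "par x"] mem[OF that(1)] mem[OF that(2)] that(3) by (simp add: beat_def)
  moreover have "card {x \<in> ch v. x \<in> B} \<le> card (ch v) div 2" for v using * B by simp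
  moreover have "ch v \<inter> B = {}" if "odd (card (ch v))" for v using that *[of v] B[of v] by auto
  moreover have "card (ch (par x)) div 2 \<le> card {y \<in> ch (par x). y \<noteq> x \<and> beat x y} + of_bool (x \<in> B)"
    if "x \<in> V - {r}" for x
    using *[of "par x"] mem[OF that] by (simp add: beat_def B_def)
  ultimately show thesis by (rule that)
qed

end

text \<open>Each bound belongs to a kind of greedy step: the two forms of \<open>k_edge\<close> to
  late tree edges and to early members of \<open>B\<close>, \<open>k_deg\<close> to leaf edges at
  the ends of intervals and to cycle edges inside an interval, \<open>k_min\<close> and
  \<open>k_deg4\<close> to cycle edges between intervals.\<close>

locale rooted_tree_cycle_bound = rooted_tree_cycle +
  fixes k :: nat
  assumes k_edge: "x \<in> V - {r} \<Longrightarrow> card (Inc x) + card (Inc (par x)) div 2 \<le> k"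
      "x \<in> V - {r} \<Longrightarrow> card (Inc (par x)) + card (Inc x) div 2 \<le> k"
    and k_deg: "x \<in> V \<Longrightarrow> card (Inc x) + 5 \<le> k"
    and k_min: "8 \<le> k"
    and k_deg4: "x \<in> V \<Longrightarrow> 4 \<le> card (Inc x) \<Longrightarrow> 10 \<le> k"
begin

subsection \<open>Coloring the tree\<close>

lemma tree_coloring:
  fixes L :: "'a \<Rightarrow> nat set"
  assumes L: "\<forall>x\<in>V - {r}. k \<le> card (L x)"
  obtains g where "\<forall>x\<in>V - {r}. g x \<in> L x"
    "\<forall>x\<in>V - {r}. \<forall>y\<in>V - {r}. par x = par y \<longrightarrow> x \<noteq> y \<longrightarrow> g x \<noteq> g y"
    "\<forall>x\<in>V - {r}. par x \<noteq> r \<longrightarrow> g x \<noteq> g (par x)"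
    "\<forall>x\<in>V - {r}. \<forall>y\<in>V - {r}. par x \<noteq> r \<longrightarrow> par y \<noteq> r \<longrightarrow> par x \<noteq> par y \<longrightarrow>
       par (par x) = par (par y) \<longrightarrow> \<not> (g x = g (par y) \<and> g y = g (par x))"
    "\<forall>y\<in>V - {r}. par y \<noteq> r \<longrightarrow> par (par y) \<noteq> r \<longrightarrow>
       (\<forall>z\<in>Inc (par (par (par y))). z \<noteq> par (par y) \<longrightarrow> \<not> (g y = g (par (par y)) \<and> g (par y) = g z))"
    "\<forall>x\<in>S. jump x \<longrightarrow> g x \<noteq> g (nx x)"
proof -
  let ?X = "V - {r}"
  obtain beat B where
    asym: "\<And>x y. x \<in> ?X \<Longrightarrow> y \<in> ?X \<Longrightarrow> par x = par y \<Longrightarrow> \<not> (beat x y \<and> beat y x)"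
    and cardB: "\<And>v. card {x \<in> ch v. x \<in> B} \<le> card (ch v) div 2"
    and oddB: "\<And>v. odd (card (ch v)) \<Longrightarrow> ch v \<inter> B = {}"
    and out: "\<And>x. x \<in> ?X \<Longrightarrow> card (ch (par x)) div 2
        \<le> card {y \<in> ch (par x). y \<noteq> x \<and> beat x y} + of_bool (x \<in> B)"
    by (fact tournament)
  \<comment> \<open>The edges above \<open>x\<close> from which \<open>x\<close> must differ. An
    inner vertex of \<open>B\<close> avoids everything at \<open>par (par x)\<close>; in return the
    edges directly below it need not avoid the edge above \<open>par x\<close>, as the last summand
    shows one level lower. A leaf has no tree edge below it, so it is spared this price even if it
    lies in \<open>B\<close>.\<close>
  define up where "up x = (if par x = r then {} else if x \<in> B \<and> x \<notin> S then Inc (par (par x)) else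
    {par x} \<union> {y \<in> ch (par (par x)). y \<noteq> par x \<and> \<not> beat (par x) y} \<union>
    (if par (par x) \<noteq> r \<and> par x \<notin> B then {par (par x)} else {}))" for x
  define cf where "cf x y \<longleftrightarrow> x \<in> ?X \<and> y \<in> ?X \<and>
    (par x = par y \<and> x \<noteq> y \<or> y \<in> up x \<or> x \<in> S \<and> y = nx x \<and> jump x)" for x y
  \<comment> \<open>Siblings in \<open>B\<close> come first because they have to avoid more colors from above, leaves at the ends
    of intervals because they have to avoid the color at the neighboring leaf.\<close>
  define early where "early x \<longleftrightarrow> (if x \<in> S then jump x \<or> jump (pv x) else x \<in> B)" for x
  define key where "key x = 2 * dep x + of_bool (\<not> early x)" for x
  \<comment> \<open>Conflicts from \<open>up\<close> lead to strictly smaller depth and hence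
    smaller key, so an edge never has to count the edges below that avoid it.\<close>
  have up_dep: "dep y < dep x" if "y \<in> up x" "x \<in> ?X" for x y
  proof -
    have "par x \<noteq> r" using that by (auto simp: up_def)
    then have "par x \<in> ?X" using par_in that by auto
    then have "dep x = Suc (Suc (dep (par (par x))))" using dep_par that by auto
    moreover have "dep y \<le> Suc (dep (par (par x)))"
      using that dep_par[OF \<open>par x \<in> ?X\<close>] dep_par[of y]
      by (auto simp: up_def Inc_def ch_def split: if_splits)
    ultimately show ?thesis by simp
  qed
  have card_up: "card (up x) \<le> card (Inc (par (par x))) div 2 + 1"
    if "x \<in> ?X" "par x \<noteq> r" "\<not> (x \<in> B \<and> x \<notin> S)" for x
  proof -
    let ?v = "par x" let ?u = "par ?v"
    let ?W = "{y \<in> ch ?u. y \<noteq> ?v \<and> beat ?v y}" and ?N = "{y \<in> ch ?u. y \<noteq> ?v \<and> \<not> beat ?v y}"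
    have v: "?v \<in> ?X" using that par_in by auto
    then have v': "?v \<in> ch ?u" by (simp add: ch_def)
    have "ch ?u = insert ?v (?W \<union> ?N)" using v' by auto
    then have "card (ch ?u) = card (insert ?v (?W \<union> ?N))" by (rule arg_cong)
    also have "\<dots> = Suc (card (?W \<union> ?N))" by (rule card_insert_disjoint) auto
    also have "card (?W \<union> ?N) = card ?W + card ?N" by (rule card_Un_disjoint) auto
    finally have m: "card (ch ?u) = Suc (card ?W + card ?N)" .
    have "card (up x) \<le> 1 + card ?N + of_bool (?u \<noteq> r \<and> ?v \<notin> B)"
    proof -
      have "card (up x) \<le> card ({?v} \<union> ?N) + card (if ?u \<noteq> r \<and> ?v \<notin> B then {?u} else {})"
        using that unfolding up_def by (simp only: if_False card_Un_le)
      also have "card ({?v} \<union> ?N) \<le> 1 + card ?N" using card_Un_le[of "{?v}" ?N] by simp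
      finally show ?thesis by auto
    qed
    moreover have "?v \<in> B \<longrightarrow> even (card (ch ?u))" using oddB[of ?u] v' by auto
    ultimately show ?thesis using m out[OF v] card_Inc[of ?u] by (rule tournament_degree_bound)
  qed
  have bound: "card {y \<in> ?X. (cf x y \<or> cf y x) \<and> key y \<le> key x} < card (L x)" if x: "x \<in> ?X" for x
  proof -
    let ?v = "par x" let ?u = "par ?v"
    define sib where "sib = {y \<in> ch ?v. y \<noteq> x \<and> key y \<le> key x}"
    define nb where "nb = {y \<in> S. x \<in> S \<and> (y = nx x \<and> jump x \<or> x = nx y \<and> jump y)}"
    have le: "dep y \<le> dep x" if "key y \<le> key x" for y
      using that by (auto simp: key_def of_bool_def split: if_splits)
    have "{y \<in> ?X. (cf x y \<or> cf y x) \<and> key y \<le> key x} \<subseteq> sib \<union> up x \<union> nb"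
    proof
      fix y assume y: "y \<in> {y \<in> ?X. (cf x y \<or> cf y x) \<and> key y \<le> key x}"
      show "y \<in> sib \<union> up x \<union> nb"
      proof (cases "cf x y")
        case True
        then show ?thesis using y by (auto simp: cf_def sib_def nb_def ch_def)
      next
        case False
        then have "cf y x" using y by simp
        moreover have "x \<notin> up y" using up_dep[of x y] le[of y] y by auto
        ultimately show ?thesis using y by (auto simp: cf_def sib_def nb_def ch_def)
      qed
    qed
    moreover have fin: "finite sib" "finite (up x)" "finite nb"
      using finite_S by (auto simp: sib_def up_def nb_def)
    ultimately have le3: "card {y \<in> ?X. (cf x y \<or> cf y x) \<and> key y \<le> key x} \<le> card sib + card (up x) + card nb"
      using card_mono[of "sib \<union> up x \<union> nb" "{y \<in> ?X. (cf x y \<or> cf y x) \<and> key y \<le> key x}"]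
        card_Un_le[of "sib \<union> up x" nb] card_Un_le[of sib "up x"] by simp
    have xch: "x \<in> ch ?v" using x by (simp add: ch_def)
    have v: "?v \<in> V" using par_in x by blast
    have sib_le: "card sib \<le> card (ch ?v) - 1"
    proof -
      have "card sib \<le> card (ch ?v - {x})" by (rule card_mono) (auto simp: sib_def)
      then show ?thesis using xch by simp
    qed
    have pos: "card (ch ?v) > 0" using xch card_gt_0_iff by fastforce
    have up_r: "up x = {}" if "?v = r" using that by (simp add: up_def)
    have u: "?v \<in> ?X" "?u \<in> V" "card (Inc ?v) = Suc (card (ch ?v))" "card (Inc ?u) > 0" if "?v \<noteq> r"
    proof -
      show "?v \<in> ?X" using v that by simp
      then show "?u \<in> V" by (rule par_in)
      have "?v \<in> Inc ?u" using \<open>?v \<in> ?X\<close> by (simp add: Inc_def ch_def)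
      then show "card (Inc ?u) > 0" by (auto simp: card_gt_0_iff)
      show "card (Inc ?v) = Suc (card (ch ?v))" using card_Inc that by simp
    qed
    have "card sib + card (up x) + card nb < k"
    proof (cases "early x")
      case False
      then have "nb = {}" by (auto simp: nb_def early_def)
      then have nb: "card nb = 0" by simp
      have nB: "\<not> (x \<in> B \<and> x \<notin> S)" using False by (simp add: early_def split: if_splits)
      show ?thesis
      proof (cases "?v = r")
        case True
        then show ?thesis using up_r[OF True] sib_le pos nb k_deg[OF v] card_Inc[of ?v] by simp
      next
        case False
        \<comment> \<open>Late edges: there are at most \<open>card (ch ?v) - 1\<close> siblings and
          at most \<open>t + 1\<close> edges from above, together one less than
          \<open>card (Inc ?v) + t\<close>.\<close>
        define t where "t = card (Inc ?u) div 2"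
        have "card (up x) \<le> t + 1" "card (Inc ?v) + t \<le> k"
          using card_up[OF x False nB] k_edge(1)[OF u(1)[OF False]] by (simp_all add: t_def)
        moreover have "card sib < card (ch ?v)" using sib_le pos by linarith
        moreover have "card (Inc ?v) = Suc (card (ch ?v))" by (rule u(3)[OF False])
        ultimately show ?thesis using nb by linarith
      qed
    next
      case True
      show ?thesis
      proof (cases "x \<in> S")
        case xS: True
        \<comment> \<open>An early leaf has only early leaves among its counted siblings, and these
          are the exit and the entry of the interval, at most one of each. With at most two leaves
          across a jump this makes four, and the summand 1 of \<open>card_up\<close> completes the
          five of \<open>k_deg\<close>.\<close>
        let ?A = "{y \<in> ch ?v. y \<in> S \<and> jump y}" and ?B = "{y \<in> ch ?v. y \<in> S \<and> jump (pv y)}"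
        have "sib \<subseteq> ?A \<union> ?B"
        proof
          fix y assume y: "y \<in> sib"
          then have yS: "y \<in> S" using S_sibling[OF xS, of y] by (simp add: sib_def ch_def)
          then have "early y" using y S_dep[OF xS yS] True by (auto simp: sib_def key_def)
          then show "y \<in> ?A \<union> ?B"
            using y yS by (auto simp: early_def sib_def)
        qed
        then have "card sib \<le> card (?A \<union> ?B)" by (intro card_mono) auto
        moreover have "card ?A \<le> Suc 0"
        proof (subst card_le_Suc0_iff_eq, simp, intro ballI)
          fix y z assume "y \<in> ?A" "z \<in> ?A"
          then have "y \<in> S" "z \<in> S" "jump y" "jump z" "par y = par z" by (simp_all add: ch_def)
          then show "y = z" using exit_unique[of y z] unfolding jump_def by blast
        qed
        moreover have "card ?B \<le> Suc 0"
        proof (subst card_le_Suc0_iff_eq, simp, intro ballI)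
          fix y z assume yz: "y \<in> ?B" "z \<in> ?B"
          then have "y \<in> S" "z \<in> S" "jump (pv y)" "jump (pv z)" "par y = par z" by (simp_all add: ch_def)
          then have "pv y = pv z" using entry_unique[of "pv y" "pv z"] by (simp add: jump_def)
          then have "nx (pv y) = nx (pv z)" by simp
          then show "y = z" using yz by simp
        qed
        moreover have "card nb \<le> 2"
        proof -
          have "nb \<subseteq> {nx x, pv x}" by (auto simp: nb_def)
          then have "card nb \<le> card {nx x, pv x}" by (intro card_mono) auto
          also have "\<dots> \<le> 2" by (simp add: card_insert_if)
          finally show ?thesis .
        qed
        ultimately have s: "card sib + card nb \<le> 4" using card_Un_le[of ?A ?B] by linarith
        show ?thesis
        proof (cases "?v = r")
          case True
          then show ?thesis using s up_r[OF True] k_min by simp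
        next
          case False
          define t where "t = card (Inc ?u) div 2"
          have "card (up x) \<le> t + 1" using card_up[OF x False] xS by (simp add: t_def)
          moreover have "t < card (Inc ?u)" using u(4)[OF False] by (simp add: t_def)
          ultimately show ?thesis using s k_deg[OF u(2)[OF False]] by linarith
        qed
      next
        case xS: False
        then have xB: "x \<in> B" using True by (simp add: early_def)
        \<comment> \<open>Members of \<open>B\<close> precede their siblings and so count only each
          other, at most half of the children. This pays for the full set \<open>Inc ?u\<close> in
          \<open>up x\<close>, by \<open>k_edge\<close> with the two ends exchanged.\<close>
        have "sib \<subseteq> {y \<in> ch ?v. y \<in> B} - {x}"
        proof
          fix y assume y: "y \<in> sib"
          then have yX: "y \<in> ?X" "par y = ?v" by (auto simp: sib_def ch_def)
          then have "y \<notin> S" using S_sibling[of y x] x xS by auto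
          moreover have "early y" using y dep_par[OF x] dep_par[of y] yX True by (auto simp: sib_def key_def)
          ultimately show "y \<in> {y \<in> ch ?v. y \<in> B} - {x}" using y by (auto simp: early_def sib_def)
        qed
        then have "card sib \<le> card ({y \<in> ch ?v. y \<in> B} - {x})" by (intro card_mono) auto
        also have "\<dots> = card {y \<in> ch ?v. y \<in> B} - 1" using xch xB by simp
        also have "\<dots> \<le> card (ch ?v) div 2 - 1" using cardB[of ?v] by simp
        finally have s: "card sib \<le> card (ch ?v) div 2 - 1" .
        have "x \<in> {y \<in> ch ?v. y \<in> B}" using xch xB by simp
        then have "card {y \<in> ch ?v. y \<in> B} > 0" by (subst card_gt_0_iff) auto
        then have p: "card (ch ?v) div 2 > 0" using cardB[of ?v] by linarith
        have nb: "card nb = 0" using xS by (simp add: nb_def)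
        have half: "card (ch ?v) div 2 \<le> card (Inc ?v) div 2"
          using card_Inc[of ?v] by (intro div_le_mono) simp
        show ?thesis
        proof (cases "?v = r")
          case True
          have "card sib < card (Inc ?v)" using s p half div_le_dividend[of "card (Inc ?v)" 2] by linarith
          then show ?thesis using nb up_r[OF True] k_deg[OF v] by simp
        next
          case False
          then have "card (up x) = card (Inc ?u)" using xB xS by (simp add: up_def)
          moreover define t where "t = card (Inc ?v) div 2"
          moreover have "card sib < t" using s p half unfolding t_def by linarith
          moreover have "card (Inc ?u) + t \<le> k" using k_edge(2)[OF u(1)[OF False]] by (simp add: t_def)
          ultimately show ?thesis using nb by linarith
        qed
      qed
    qed
    then show ?thesis using le3 bspec[OF L x] by linarith
  qed
  have irr: "\<not> (cf x x \<or> cf x x)" for x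
    using up_dep[of x x] nx_neq by (auto simp: cf_def jump_def)
  obtain g where g: "\<And>x. x \<in> ?X \<Longrightarrow> g x \<in> L x" "\<And>x y. x \<in> ?X \<Longrightarrow> y \<in> ?X \<Longrightarrow> cf x y \<Longrightarrow> g x \<noteq> g y"
  proof -
    have "\<exists>g. (\<forall>x\<in>?X. g x \<in> L x) \<and> (\<forall>x\<in>?X. \<forall>y\<in>?X. cf x y \<or> cf y x \<longrightarrow> g x \<noteq> g y)"
    proof (rule greedy_list_coloring[where key = key])
      show "finite ?X" using finite_V by simp
    qed (use irr bound in blast)+
    then show ?thesis using that by blast
  qed
  show thesis
  proof (rule that[of g]; intro ballI impI)
    fix x assume "x \<in> ?X" then show "g x \<in> L x" by (rule g)
  next
    fix x y assume "x \<in> ?X" "y \<in> ?X" "par x = par y" "x \<noteq> y"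
    then show "g x \<noteq> g y" by (intro g) (auto simp: cf_def)
  next
    fix x assume x: "x \<in> ?X" "par x \<noteq> r"
    then have "par x \<in> ?X" using par_in by auto
    then have "par x \<in> up x" using x by (auto simp: up_def Inc_def ch_def)
    then show "g x \<noteq> g (par x)" using x \<open>par x \<in> ?X\<close> by (intro g) (auto simp: cf_def)
  next
    \<comment> \<open>Reusing the color of the edge above \<open>par y\<close> requires that
      \<open>par x\<close> beats \<open>par y\<close>. Both equalities together would require wins
      in both directions.\<close>
    have *: "beat (par x) (par y)" if "x \<in> ?X" "y \<in> ?X" "par x \<noteq> r" "par y \<noteq> r" "par x \<noteq> par y"
      "par (par x) = par (par y)" "g x = g (par y)" for x y
    proof (rule ccontr)
      assume "\<not> beat (par x) (par y)"
      moreover have "par y \<in> ?X" using that par_in by auto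
      ultimately have "par y \<in> up x" using that by (auto simp: up_def Inc_def ch_def)
      then have "g x \<noteq> g (par y)" using that \<open>par y \<in> ?X\<close> by (intro g) (auto simp: cf_def)
      then show False using that by simp
    qed
    fix x y assume "x \<in> ?X" "y \<in> ?X" "par x \<noteq> r" "par y \<noteq> r" "par x \<noteq> par y" "par (par x) = par (par y)"
    then show "\<not> (g x = g (par y) \<and> g y = g (par x))"
      using *[of x y] *[of y x] asym[of "par x" "par y"] par_in by auto
  next
    fix y z assume y: "y \<in> ?X" "par y \<noteq> r" "par (par y) \<noteq> r" and z: "z \<in> Inc (par (par (par y)))" "z \<noteq> par (par y)"
    have X: "par y \<in> ?X" "par (par y) \<in> ?X" using y par_in by auto
    have zX: "z \<in> ?X" using z par_in[OF X(2)] by (auto simp: Inc_def ch_def)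
    show "\<not> (g y = g (par (par y)) \<and> g (par y) = g z)"
    \<comment> \<open>Membership of \<open>par y\<close> in \<open>B\<close> decides which equality
      fails: either \<open>par y\<close> avoids all colors at the far vertex, or \<open>y\<close>
      avoids the color two levels up.\<close>
    proof (cases "par y \<in> B")
      case True
      have "par y \<notin> S" using S_childless y by blast
      then have "z \<in> up (par y)" using True y z by (simp add: up_def)
      then have "g (par y) \<noteq> g z" using X zX by (intro g) (auto simp: cf_def)
      then show ?thesis by simp
    next
      case False
      then have "par (par y) \<in> up y" using y X by (auto simp: up_def Inc_def)
      then have "g y \<noteq> g (par (par y))" using X y by (intro g) (auto simp: cf_def)
      then show ?thesis by simp
    qed
  next
    fix x assume x: "x \<in> S" "jump x"
    then have "x \<in> ?X" "nx x \<in> ?X" using S_subset nx_in by blast+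
    then show "g x \<noteq> g (nx x)" using x by (intro g) (simp_all add: cf_def)
  qed
qed

subsection \<open>Coloring the cycle\<close>

lemma card_le_2: "card {a, b} \<le> 2" by (simp add: card_insert_if)

text \<open>Apart from the colors at the common parent there are always at most four restrictions.
  Each neighboring cycle edge contributes either its own color or, if it is a jump and still
  uncolored, the tree color at its far end; each cycle edge at distance two contributes at most one
  color. So \<open>card (Inc (par x)) + 5\<close> colors suffice.\<close>

lemma same_edge_coloring:
  fixes L :: "'a \<Rightarrow> nat set" and g :: "'a \<Rightarrow> nat"
  assumes L: "\<forall>x\<in>S. finite (L x) \<and> k \<le> card (L x)"
  shows "\<exists>h. (\<forall>x\<in>S. \<not> jump x \<longrightarrow> h x \<in> L x \<and> (\<forall>z\<in>Inc (par x). h x \<noteq> g z) \<and>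
    (jump (pv x) \<longrightarrow> h x \<noteq> g (pv x)) \<and> (jump (nx x) \<longrightarrow> h x \<noteq> g (nx (nx x))) \<and>
    (\<not> jump (nx x) \<longrightarrow> h x \<noteq> h (nx x)) \<and> (\<not> jump (nx (nx x)) \<longrightarrow> h x \<noteq> h (nx (nx x))))"
proof -
  define X where "X = {x \<in> S. \<not> jump x}"
  define F where "F x = g ` Inc (par x) \<union> (if jump (pv x) then {g (pv x)} else {}) \<union>
    (if jump (nx x) then {g (nx (nx x))} else {})" for x
  define cf where "cf x y \<longleftrightarrow> x \<in> S \<and> y \<in> S \<and> (y = nx x \<or> x = nx y \<or> y = nx (nx x) \<or> x = nx (nx y))"
    for x y
  have "\<exists>h. (\<forall>x\<in>X. h x \<in> L x - F x) \<and> (\<forall>x\<in>X. \<forall>y\<in>X. cf x y \<longrightarrow> h x \<noteq> h y)"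
  proof (rule greedy_list_coloring[where key = "\<lambda>_. 0"])
    show "finite X" using finite_S by (simp add: X_def)
    show "cf y x" if "cf x y" for x y using that by (auto simp: cf_def)
    show "\<not> cf x x" for x using nx_neq[of x] nx_nx_neq[of x] by (auto simp: cf_def)
    fix x assume "x \<in> X"
    then have x: "x \<in> S" "\<not> jump x" by (auto simp: X_def)
    let ?N1 = "if jump (nx x) then {} else {nx x}" and ?N2 = "if jump (pv x) then {} else {pv x}"
    let ?N3 = "{nx (nx x), pv (pv x)}"
    have "{y \<in> X. cf x y \<and> (0::nat) \<le> 0} \<subseteq> ?N1 \<union> ?N2 \<union> ?N3"
    proof
      fix y assume "y \<in> {y \<in> X. cf x y \<and> (0::nat) \<le> 0}"
      then have y: "y \<in> S" "\<not> jump y" "cf x y" by (auto simp: X_def)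
      then consider "y = nx x" | "x = nx y" | "y = nx (nx x)" | "x = nx (nx y)"
        by (auto simp: cf_def)
      then show "y \<in> ?N1 \<union> ?N2 \<union> ?N3" using y by cases auto
    qed
    then have "card {y \<in> X. cf x y \<and> (0::nat) \<le> 0} \<le> card (?N1 \<union> ?N2 \<union> ?N3)"
      by (intro card_mono) auto
    also have "\<dots> \<le> card ?N1 + card ?N2 + 2"
      using card_Un_le[of "?N1 \<union> ?N2" ?N3] card_Un_le[of ?N1 ?N2] card_le_2[of "nx (nx x)" "pv (pv x)"]
      by linarith
    finally have N: "card {y \<in> X. cf x y \<and> (0::nat) \<le> 0} \<le> of_bool (\<not> jump (nx x)) + of_bool (\<not> jump (pv x)) + 2"
      by (cases "jump (nx x)"; cases "jump (pv x)") simp_all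
    have "card (F x) \<le> card (g ` Inc (par x)) + of_bool (jump (pv x)) + of_bool (jump (nx x))"
    proof -
      let ?A = "if jump (pv x) then {g (pv x)} else {}" and ?B = "if jump (nx x) then {g (nx (nx x))} else {}"
      have "card (F x) \<le> card (g ` Inc (par x)) + card ?A + card ?B"
        using card_Un_le[of "g ` Inc (par x) \<union> ?A" ?B] card_Un_le[of "g ` Inc (par x)" ?A]
        unfolding F_def by linarith
      then show ?thesis by (cases "jump (nx x)"; cases "jump (pv x)") simp_all
    qed
    moreover have "card (g ` Inc (par x)) \<le> card (Inc (par x))" by (rule card_image_le) simp
    moreover have "par x \<in> V" using par_in S_subset x by blast
    moreover have "card (L x) - card (F x) \<le> card (L x - F x)" 
      by (rule diff_card_le_card_Diff) (simp add: F_def)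
    ultimately show "card {y \<in> X. cf x y \<and> (0::nat) \<le> 0} < card (L x - F x)"
      using N k_deg[of "par x"] bspec[OF L x(1)] by (cases "jump (nx x)"; cases "jump (pv x)") auto
  qed
  then obtain h where h: "\<And>x. x \<in> X \<Longrightarrow> h x \<in> L x - F x"
    "\<And>x y. x \<in> X \<Longrightarrow> y \<in> X \<Longrightarrow> cf x y \<Longrightarrow> h x \<noteq> h y" by blast
  show ?thesis
  proof (intro exI[of _ h] ballI impI)
    fix x assume "x \<in> S" "\<not> jump x"
    then have x: "x \<in> X" "x \<in> S" by (auto simp: X_def)
    have "h x \<noteq> h y" if "\<not> jump y" "y = nx x \<or> y = nx (nx x)" for y
    proof -
      have "y \<in> S" using x(2) that by auto
      then show ?thesis using that x by (intro h) (auto simp: X_def cf_def)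
    qed
    moreover have "h x \<in> L x" "h x \<notin> F x" using h(1)[OF x(1)] by auto
    ultimately show "h x \<in> L x \<and> (\<forall>z\<in>Inc (par x). h x \<noteq> g z) \<and>
      (jump (pv x) \<longrightarrow> h x \<noteq> g (pv x)) \<and> (jump (nx x) \<longrightarrow> h x \<noteq> g (nx (nx x))) \<and>
      (\<not> jump (nx x) \<longrightarrow> h x \<noteq> h (nx x)) \<and> (\<not> jump (nx (nx x)) \<longrightarrow> h x \<noteq> h (nx (nx x)))"
      by (auto simp: F_def)
  qed
qed

lemma card_Inc_ge_4:
  assumes "x \<in> S" "y \<in> S" "z \<in> S" "par x = v" "par y = v" "par z = v" "x \<noteq> y" "y \<noteq> z" "x \<noteq> z" "v \<noteq> r"
  shows "4 \<le> card (Inc v)"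
proof -
  have "{x, y, z} \<subseteq> ch v" using assms S_subset by (auto simp: ch_def)
  then have "card {x, y, z} \<le> card (ch v)" by (rule card_mono[rotated]) simp
  then show ?thesis using assms card_Inc[of v] by simp
qed

text \<open>Jumps are colored after all other cycle edges. No two of them are adjacent, so their
  colors can be chosen independently of each other. The price is that two jumps at distance two may
  share a color, which the last conclusion records and \<open>walk_fw_fw\<close> shows to be
  harmless.\<close>

lemma cycle_coloring:
  fixes L :: "'a \<Rightarrow> nat set" and g :: "'a \<Rightarrow> nat"
  assumes L: "\<forall>x\<in>S. finite (L x) \<and> k \<le> card (L x)"
  obtains h where "\<forall>x\<in>S. h x \<in> L x" "\<forall>x\<in>S. h x \<noteq> h (nx x)"
    "\<forall>x\<in>S. \<not> jump x \<longrightarrow> (\<forall>z\<in>Inc (par x). h x \<noteq> g z) \<and>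
      (jump (pv x) \<longrightarrow> h x \<noteq> g (pv x)) \<and> (jump (nx x) \<longrightarrow> h x \<noteq> g (nx (nx x)))"
    "\<forall>x\<in>S. jump x \<longrightarrow> h x \<notin> {g x, g (nx x), g (par x), g (par (nx x))} \<and>
      (\<forall>y\<in>S. jump y \<longrightarrow> par (nx y) = par x \<longrightarrow> h x \<noteq> g (nx y))"
    "\<forall>x\<in>S. h x = h (nx (nx x)) \<longrightarrow> jump x \<and> jump (nx (nx x))"
proof -
  from same_edge_coloring[where g = g and L = L, OF L] obtain h1 where
    h1: "\<And>x. x \<in> S \<Longrightarrow> \<not> jump x \<Longrightarrow> h1 x \<in> L x \<and> (\<forall>z\<in>Inc (par x). h1 x \<noteq> g z) \<and>
    (jump (pv x) \<longrightarrow> h1 x \<noteq> g (pv x)) \<and> (jump (nx x) \<longrightarrow> h1 x \<noteq> g (nx (nx x))) \<and>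
    (\<not> jump (nx x) \<longrightarrow> h1 x \<noteq> h1 (nx x)) \<and> (\<not> jump (nx (nx x)) \<longrightarrow> h1 x \<noteq> h1 (nx (nx x)))"
    by blast
  define E where "E x = {y \<in> S. jump y \<and> par (nx y) = par x}" for x
  \<comment> \<open>Seven colors: four on the tree edges at the two leaves and above their parents,
    one at the leaf where the interval of \<open>x\<close> is entered, two on the neighboring cycle
    edges. The conditional set adds two more; it may contain an arbitrary value of \<open>h1\<close>
    at a jump, which merely forbids one more color.\<close>
  define F where "F x = {g x, g (nx x), g (par x), g (par (nx x))} \<union> (\<lambda>y. g (nx y)) ` E x \<union> {h1 (nx x), h1 (pv x)} \<union>
     (if \<not> jump (nx (nx x)) \<or> \<not> jump (pv (pv x)) then {h1 (nx (nx x)), h1 (pv (pv x))} else {})" for x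
  have "\<exists>c. c \<in> L x - F x" if x: "x \<in> S" "jump x" for x
  proof -
    let ?P = "\<not> jump (nx (nx x)) \<or> \<not> jump (pv (pv x))"
    have "card {g x, g (nx x), g (par x), g (par (nx x))} \<le> 4" by (simp add: card_insert_if)
    moreover have "card (E x) \<le> Suc 0"
    proof (subst card_le_Suc0_iff_eq)
      show "finite (E x)" using finite_S by (simp add: E_def)
      show "\<forall>y\<in>E x. \<forall>z\<in>E x. y = z"
      proof (intro ballI)
        fix y z assume "y \<in> E x" "z \<in> E x"
        then have "y \<in> S" "z \<in> S" "jump y" "jump z" "par (nx y) = par (nx z)" by (simp_all add: E_def)
        then show "y = z" using entry_unique[of y z] unfolding jump_def by blast
      qed
    qed
    moreover have "card ((\<lambda>y. g (nx y)) ` E x) \<le> card (E x)"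
      by (rule card_image_le) (use finite_S in \<open>simp add: E_def\<close>)
    moreover have "card {h1 (nx x), h1 (pv x)} \<le> 2" by (rule card_le_2)
    moreover have "card (if ?P then {h1 (nx (nx x)), h1 (pv (pv x))} else {}) \<le> 2 * of_bool ?P"
      using card_le_2[of "h1 (nx (nx x))" "h1 (pv (pv x))"] by (cases ?P) (simp_all only: if_True if_False of_bool_eq, simp_all)
    ultimately have F: "card (F x) \<le> 7 + 2 * of_bool ?P"
      using card_Un_le[of "{g x, g (nx x), g (par x), g (par (nx x))}" "(\<lambda>y. g (nx y)) ` E x"]
        card_Un_le[of "{g x, g (nx x), g (par x), g (par (nx x))} \<union> (\<lambda>y. g (nx y)) ` E x" "{h1 (nx x), h1 (pv x)}"]
        card_Un_le[of "{g x, g (nx x), g (par x), g (par (nx x))} \<union> (\<lambda>y. g (nx y)) ` E x \<union> {h1 (nx x), h1 (pv x)}"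
          "if ?P then {h1 (nx (nx x)), h1 (pv (pv x))} else {}"]
      unfolding F_def by linarith
    \<comment> \<open>If the cycle edge two steps away is no jump, the interval on that side
      contains three leaves. Together with the edge above their parent they give degree
      four.\<close>
    have "10 \<le> k" if P: ?P
    proof -
      have nr: "par x \<noteq> r" "par (nx x) \<noteq> r" using jump_par_not_root[OF x] by auto
      have V: "par x \<in> V" "par (nx x) \<in> V" using x S_subset par_in nx_in by blast+
      show ?thesis
      proof (cases "jump (nx (nx x))")
        case False
        have "4 \<le> card (Inc (par (nx x)))"
          by (rule card_Inc_ge_4[of "nx x" "nx (nx x)" "nx (nx (nx x))"])
            (use x False jump_nx[OF x] nr nx_neq[of "nx x"] nx_neq[of "nx (nx x)"] nx_nx_neq[of "nx x"] in
              \<open>auto simp: jump_def\<close>)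
        then show ?thesis using k_deg4 V by blast
      next
        case True
        then have P: "\<not> jump (pv (pv x))" using P by simp
        have "par (pv x) = par x" "par (pv (pv x)) = par x"
          using P jump_pv[OF x] x by (simp_all add: jump_def)
        moreover have "pv x \<noteq> x" "pv (pv x) \<noteq> pv x" "pv (pv x) \<noteq> x"
          using x nx_neq[of "pv x"] nx_neq[of "pv (pv x)"] nx_nx_neq[of "pv (pv x)"] by auto
        ultimately have "4 \<le> card (Inc (par x))"
          by (intro card_Inc_ge_4[of x "pv x" "pv (pv x)"]) (use x nr in auto)
        then show ?thesis using k_deg4 V by blast
      qed
    qed
    then have "card (F x) < card (L x)" using F k_min bspec[OF L x(1)] by (cases ?P) auto
    moreover have "finite (F x)" using finite_S by (simp add: F_def E_def)
    ultimately have "L x - F x \<noteq> {}" by (metis Diff_eq_empty_iff card_mono leD)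
    then show ?thesis by blast
  qed
  then obtain c where c: "\<And>x. x \<in> S \<Longrightarrow> jump x \<Longrightarrow> c x \<in> L x - F x" by metis
  define h where "h x = (if jump x then c x else h1 x)" for x
  have hj: "h x \<in> L x" "h x \<notin> F x" if "x \<in> S" "jump x" for x using c[OF that] that by (auto simp: h_def)
  have hs: "h x = h1 x" if "\<not> jump x" for x using that by (simp add: h_def)
  show thesis
  proof (rule that[of h]; intro ballI)
    fix x assume x: "x \<in> S"
    show "h x \<in> L x" using hj h1 hs x by (cases "jump x") auto
    show "h x \<noteq> h (nx x)"
    proof (cases "jump x")
      case True
      then show ?thesis using hj(2)[OF x True] hs jump_nx[OF x True] by (auto simp: F_def)
    next
      case same: False
      show ?thesis
      proof (cases "jump (nx x)")
        case True
        then show ?thesis using hj(2)[of "nx x"] hs[OF same] x by (auto simp: F_def)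
      next
        case False
        then show ?thesis using h1[OF x same] hs[OF same] hs[OF False] by auto
      qed
    qed
    show "\<not> jump x \<longrightarrow> (\<forall>z\<in>Inc (par x). h x \<noteq> g z) \<and>
      (jump (pv x) \<longrightarrow> h x \<noteq> g (pv x)) \<and> (jump (nx x) \<longrightarrow> h x \<noteq> g (nx (nx x)))"
      using h1[OF x] hs[of x] by auto
    show "jump x \<longrightarrow> h x \<notin> {g x, g (nx x), g (par x), g (par (nx x))} \<and>
      (\<forall>y\<in>S. jump y \<longrightarrow> par (nx y) = par x \<longrightarrow> h x \<noteq> g (nx y))"
      using hj(2)[OF x] by (auto simp: F_def E_def)
    show "h x = h (nx (nx x)) \<longrightarrow> jump x \<and> jump (nx (nx x))"
    proof (rule impI, rule ccontr)
      assume eq: "h x = h (nx (nx x))" and "\<not> (jump x \<and> jump (nx (nx x)))"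
      then consider "jump x" "\<not> jump (nx (nx x))" | "\<not> jump x" "jump (nx (nx x))" | "\<not> jump x" "\<not> jump (nx (nx x))"
        by blast
      then show False
      proof cases
        case 1
        then show ?thesis using hj(2)[OF x] hs eq by (auto simp: F_def)
      next
        case 2
        then show ?thesis using hj(2)[of "nx (nx x)"] x hs[of x] eq by (auto simp: F_def)
      next
        case 3
        then show ?thesis using h1[OF x] hs eq by auto
      qed
    qed
  qed
qed

end

section \<open>Absence of bichromatic walks\<close>

text \<open>Here \<open>g\<close> colors the edges of the tree and \<open>h\<close> the edges of the cycle, named as above.\<close>

locale tree_cycle_coloring = rooted_tree_cycle +
  fixes g h :: "'a \<Rightarrow> nat"
  assumes g_sibling: "\<lbrakk>x \<in> V - {r}; y \<in> V - {r}; par x = par y; x \<noteq> y\<rbrakk> \<Longrightarrow> g x \<noteq> g y"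
    and g_par: "\<lbrakk>x \<in> V - {r}; par x \<noteq> r\<rbrakk> \<Longrightarrow> g x \<noteq> g (par x)"
    and g_cousin: "\<lbrakk>x \<in> V - {r}; y \<in> V - {r}; par x \<noteq> r; par y \<noteq> r; par x \<noteq> par y; par (par x) = par (par y);
      g x = g (par y); g y = g (par x)\<rbrakk> \<Longrightarrow> False"
    and g_chain: "\<lbrakk>y \<in> V - {r}; par y \<noteq> r; par (par y) \<noteq> r; z \<in> Inc (par (par (par y))); z \<noteq> par (par y);
      g y = g (par (par y)); g (par y) = g z\<rbrakk> \<Longrightarrow> False"
    and g_jump: "\<lbrakk>x \<in> S; jump x\<rbrakk> \<Longrightarrow> g x \<noteq> g (nx x)"
    and h_nx: "x \<in> S \<Longrightarrow> h x \<noteq> h (nx x)"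
    and h_Inc: "\<lbrakk>x \<in> S; \<not> jump x; z \<in> Inc (par x)\<rbrakk> \<Longrightarrow> h x \<noteq> g z"
    and h_prev: "\<lbrakk>x \<in> S; \<not> jump x; jump (pv x)\<rbrakk> \<Longrightarrow> h x \<noteq> g (pv x)"
    and h_next: "\<lbrakk>x \<in> S; \<not> jump x; jump (nx x)\<rbrakk> \<Longrightarrow> h x \<noteq> g (nx (nx x))"
    and h_jump: "\<lbrakk>x \<in> S; jump x\<rbrakk> \<Longrightarrow> h x \<notin> {g x, g (nx x), g (par x), g (par (nx x))}"
    and h_block: "\<lbrakk>x \<in> S; jump x; y \<in> S; jump y; par (nx y) = par x\<rbrakk> \<Longrightarrow> h x \<noteq> g (nx y)"
    and h_nx_nx: "\<lbrakk>x \<in> S; h x = h (nx (nx x))\<rbrakk> \<Longrightarrow> jump x \<and> jump (nx (nx x))"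
begin

lemma S_X: "x \<in> S \<Longrightarrow> x \<in> V - {r}" using S_subset by auto

definition up :: "'a \<Rightarrow> 'a \<Rightarrow> bool" where "up a b \<longleftrightarrow> a \<in> V - {r} \<and> b = par a"
definition fw :: "'a \<Rightarrow> 'a \<Rightarrow> bool" where "fw a b \<longleftrightarrow> a \<in> S \<and> b = nx a"
definition adj :: "'a \<Rightarrow> 'a \<Rightarrow> bool" where "adj a b \<longleftrightarrow> up a b \<or> up b a \<or> fw a b \<or> fw b a"

text \<open>For adjacent pairs exactly one branch condition can apply up to orientation; the last
  branch also serves as default value for nonadjacent pairs.\<close>

definition col :: "'a \<Rightarrow> 'a \<Rightarrow> nat" where
  "col a b = (if up a b then g a else if up b a then g b else if fw a b then h a else h b)"

lemma up_asym: "up a b \<Longrightarrow> \<not> up b a"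
  using dep_par[of a] dep_par[of b] by (auto simp: up_def)

lemma fw_asym: "fw a b \<Longrightarrow> \<not> fw b a"
  using nx_nx_neq[of a] by (auto simp: fw_def)

lemma fw_inj: "fw a c \<Longrightarrow> fw b c \<Longrightarrow> a = b"
  using pv_nx unfolding fw_def by metis

lemma fw_not_up: "fw a b \<Longrightarrow> \<not> up a b \<and> \<not> up b a"
  using S_childless[of b a] S_childless[of a b] by (auto simp: up_def fw_def)

lemma col_up: "up a b \<Longrightarrow> col a b = g a" and col_down: "up b a \<Longrightarrow> col a b = g b"
  and col_fw: "fw a b \<Longrightarrow> col a b = h a" and col_bw: "fw b a \<Longrightarrow> col a b = h b"
  using up_asym fw_asym fw_not_up by (auto simp: col_def)

lemma col_commute: "adj a b \<Longrightarrow> col a b = col b a"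
  by (auto simp: adj_def col_up col_down col_fw col_bw)

lemma adj_commute: "adj a b \<longleftrightarrow> adj b a" by (auto simp: adj_def)

lemmas col_simps = col_up col_down col_fw col_bw

lemma up_leaf: "up a b \<Longrightarrow> b \<notin> S" using S_childless by (auto simp: up_def)

text \<open>Up to reversal, the two middle edges of a non-backtracking walk of length four are of one of
  the five kinds treated in the next lemmas.\<close>

lemma walk_up_down:
  assumes m: "up b c" "up d c" "b \<noteq> d" and "adj a b" "adj d e" "a \<noteq> c" "c \<noteq> e"
    and eq: "col a b = col c d" "col b c = col d e"
  shows False
proof -
  have X: "b \<in> V - {r}" "d \<in> V - {r}" "par b = par d" using m by (auto simp: up_def)
  have S: "b \<in> S \<longleftrightarrow> d \<in> S" using S_sibling[of b d] S_sibling[of d b] X by auto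
  have eq': "col a b = g d" "g b = col d e" using eq m by (simp_all add: col_simps)
  show False
  proof (cases "b \<in> S")
    case False
    then have "up a b" "up e d"
      using assms S by (auto simp: adj_def fw_def up_def)
    then have "a \<in> V - {r}" "par a = b" "e \<in> V - {r}" "par e = d" "g a = g d" "g e = g b"
      using eq' by (auto simp: up_def col_simps)
    then show False using g_cousin[of a e] X m(3) by auto
  next
    case True
    then have S2: "b \<in> S" "d \<in> S" using S by auto
    then have "\<not> up a b" "\<not> up e d" using up_leaf by auto
    moreover have "\<not> up b a" "\<not> up d e" using assms X by (auto simp: up_def)
    ultimately have "fw a b \<or> fw b a" and "fw d e \<or> fw e d" using assms by (auto simp: adj_def)
    then obtain x y where x: "x \<in> S" "b = x \<or> b = nx x" "h x = g d"
      and y: "y \<in> S" "d = y \<or> d = nx y" "h y = g b"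
      using eq' col_fw col_bw by (metis fw_def)
    have Inc: "b \<in> Inc (par b)" "d \<in> Inc (par b)" using X by (auto simp: Inc_def ch_def)
    \<comment> \<open>Cycle edges inside the interval avoid all tree colors at the common parent, so
      both cycle edges of the walk must be jumps. As there is only one exit and one entry, they are
      the two of them, and the exit avoids the tree color at the entry leaf, which breaks one of the
      two equalities.\<close>
    have jx: "jump x"
    proof (rule ccontr)
      assume nj: "\<not> jump x"
      then have "par x = par b" using x(2) by (auto simp: jump_def)
      then show False using h_Inc[OF x(1) nj, of d] Inc x(3) by simp
    qed
    have jy: "jump y"
    proof (rule ccontr)
      assume nj: "\<not> jump y"
      then have "par y = par b" using y(2) X by (auto simp: jump_def)
      then show False using h_Inc[OF y(1) nj, of b] Inc y(3) by simp
    qed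
    show False
      using x(2) y(2)
    proof (elim disjE)
      assume "b = x" "d = y"
      then show False using exit_unique[of x y] x y jx jy X m(3) by (auto simp: jump_def)
    next
      assume "b = x" "d = nx y"
      then show False using h_block[of x y] x y jx jy X by auto
    next
      assume "b = nx x" "d = y"
      then show False using h_block[of y x] x y jx jy X by auto
    next
      assume "b = nx x" "d = nx y"
      then show False using entry_unique[of x y] x y jx jy X m(3) by (auto simp: jump_def)
    qed
  qed
qed

lemma walk_down_down:
  assumes m: "up c b" "up d c" and "adj a b" "adj d e" "a \<noteq> c" "c \<noteq> e"
    and eq: "col a b = col c d" "col b c = col d e"
  shows False
proof -
  have X: "c \<in> V - {r}" "d \<in> V - {r}" "par d = c" "par c = b" using m by (auto simp: up_def)
  have eq': "col a b = g d" "g c = col d e" using eq m by (simp_all add: col_simps)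
  have "b \<notin> S" using m up_leaf by auto
  then have ab: "up a b \<or> up b a" using assms by (auto simp: adj_def fw_def)
  define z where "z = (if up a b then a else b)"
  have z: "z \<in> Inc b" "col a b = g z" "z \<noteq> c"
    using ab \<open>a \<noteq> c\<close> m(1) up_asym[of c b] by (auto simp: z_def col_simps) (auto simp: up_def Inc_def ch_def)
  from \<open>adj d e\<close> consider "up e d" | "fw d e" | "fw e d"
    using X \<open>c \<noteq> e\<close> by (auto simp: adj_def up_def)
  then show False
  proof cases
    case 1
    then show False using g_chain[of e z] X z eq' by (auto simp: up_def col_simps)
  next
    case 2
    \<comment> \<open>At a leaf \<open>d\<close> the walk continues on the cycle, and there it is
      the cycle edge that avoids the color of the tree edge above the parent \<open>c\<close>,
      whether it is a jump or not.\<close>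
    then have d: "d \<in> S" "h d = g c" using eq' by (auto simp: fw_def col_simps)
    then show False using h_Inc[of d c] h_jump[of d] X by (cases "jump d") (auto simp: Inc_def)
  next
    case 3
    then have e: "e \<in> S" "h e = g c" "nx e = d" using eq' by (auto simp: fw_def col_simps)
    then show False using h_Inc[of e c] h_jump[of e] X by (cases "jump e") (auto simp: Inc_def jump_def)
  qed
qed

lemma walk_down_fw:
  assumes m: "up c b" "fw c d" and "adj a b" "adj d e" "a \<noteq> c" "c \<noteq> e"
    and eq: "col a b = col c d" "col b c = col d e"
  shows False
proof -
  have X: "c \<in> V - {r}" "c \<in> S" "d = nx c" "d \<in> S" "par c = b" using m by (auto simp: up_def fw_def)
  have eq': "col a b = h c" "g c = col d e" using eq m by (simp_all add: col_simps)
  have "b \<notin> S" using m up_leaf by auto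
  then have ab: "up a b \<or> up b a" using assms by (auto simp: adj_def fw_def)
  then obtain z where z: "z \<in> Inc b" "col a b = g z"
    by (auto simp: col_simps) (auto simp: up_def Inc_def ch_def)
  \<comment> \<open>A cycle edge with a tree color from the parent of its end must be a jump. What
    follows it is either the tree edge at its far end, excluded by \<open>g_jump\<close>, or an edge
    inside the next interval, excluded by \<open>h_prev\<close>.\<close>
  then have j: "jump c" using h_Inc[of c z] X eq' by auto
  have "\<not> up e d" using X(4) up_leaf by blast
  moreover have "\<not> fw e d" using m(2) fw_inj \<open>c \<noteq> e\<close> by blast
  ultimately consider "up d e" | "fw d e" using \<open>adj d e\<close> by (auto simp: adj_def)
  then show False
  proof cases
    case 1
    then show False using g_jump[of c] X j eq' by (auto simp: col_simps)
  next
    case 2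
    then show False using h_prev[of d] jump_nx[of c] X j eq' by (auto simp: col_simps)
  qed
qed

lemma walk_down_bw:
  assumes m: "up c b" "fw d c" and "adj a b" "adj d e" "a \<noteq> c" "c \<noteq> e"
    and eq: "col a b = col c d" "col b c = col d e"
  shows False
proof -
  have X: "c \<in> V - {r}" "c \<in> S" "c = nx d" "d \<in> S" "par c = b" using m by (auto simp: up_def fw_def)
  have eq': "col a b = h d" "g c = col d e" using eq m by (simp_all add: col_simps)
  have "b \<notin> S" using m up_leaf by auto
  then have ab: "up a b \<or> up b a" using assms by (auto simp: adj_def fw_def)
  then obtain z where z: "z \<in> Inc b" "col a b = g z"
    by (auto simp: col_simps) (auto simp: up_def Inc_def ch_def)
  then have j: "jump d" using h_Inc[of d z] X eq' by (auto simp: jump_def)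
  have "\<not> up e d" using X(4) up_leaf by blast
  moreover have "\<not> fw d e" using X \<open>c \<noteq> e\<close> by (auto simp: fw_def)
  ultimately consider "up d e" | "fw e d" using \<open>adj d e\<close> by (auto simp: adj_def)
  then show False
  proof cases
    case 1
    then show False using g_jump[of d] X j eq' by (auto simp: col_simps)
  next
    case 2
    then have "e \<in> S" "nx e = d" by (auto simp: fw_def)
    then show False using h_next[of e] jump_nx[of e] X j eq' 2 by (auto simp: col_simps)
  qed
qed

lemma walk_fw_fw:
  assumes m: "fw b c" "fw c d" and "adj a b" "adj d e" "a \<noteq> c" "c \<noteq> e"
    and eq: "col a b = col c d" "col b c = col d e"
  shows False
proof -
  have X: "b \<in> S" "c \<in> S" "d \<in> S" "c = nx b" "d = nx c" using m by (auto simp: fw_def)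
  have eq': "col a b = h c" "h b = col d e" using eq m by (simp_all add: col_simps)
  have Inc: "x \<in> Inc (par x)" if "x \<in> S" for x using S_X[OF that] by (simp add: Inc_def ch_def)
  have A: "g b \<noteq> h c" if "\<not> jump c"
    using that h_prev[of c] h_Inc[of c b] Inc[of b] X by (cases "jump b") (auto simp: jump_def)
  have D: "g d \<noteq> h b" if "\<not> jump b"
    using that h_next[of b] h_Inc[of b d] Inc[of d] X by (cases "jump c") (auto simp: jump_def)
  have "\<not> up a b" "\<not> up e d" using X(1,3) up_leaf by blast+
  moreover have "\<not> fw b a" using X(4) \<open>a \<noteq> c\<close> by (simp add: fw_def)
  moreover have "\<not> fw e d" using m(2) fw_inj \<open>c \<noteq> e\<close> by blast
  ultimately have 1: "up b a \<or> fw a b" and 2: "up d e \<or> fw d e" using assms by (auto simp: adj_def)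
  \<comment> \<open>The first equality forces \<open>c\<close> to jump: either \<open>h c\<close>
    would equal a tree color that it avoids, or two cycle edges at distance two agree. Consecutive
    jumps do not exist, so \<open>b\<close> does not jump, and the second equality fails by the
    symmetric argument.\<close>
  have jc: "jump c"
  proof (rule ccontr)
    assume nj: "\<not> jump c"
    from 1 show False
    proof
      assume "up b a"
      then show False using A[OF nj] eq' by (simp add: col_simps)
    next
      assume "fw a b"
      then show False using h_nx_nx[of a] nj X eq' by (auto simp: col_simps fw_def)
    qed
  qed
  then have nb: "\<not> jump b" using jump_nx[of b] X by auto
  from 2 show False
  proof
    assume "up d e"
    then show False using D[OF nb] eq' by (simp add: col_simps)
  next
    assume "fw d e"
    then show False using h_nx_nx[of b] nb X eq' by (auto simp: col_simps)
  qed
qed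

text \<open>The upper end of a tree edge is never a leaf, so a walk changes between tree and cycle
  only at the lower end of a tree edge. The last four shapes are the reversals of the second to the
  fifth.\<close>

lemma walk_cases:
  assumes "adj b c" "adj c d" "b \<noteq> d"
  shows "up b c \<and> up d c \<or> up c b \<and> up d c \<or> up c b \<and> fw c d \<or> up c b \<and> fw d c \<or> fw b c \<and> fw c d \<or>
    up b c \<and> up c d \<or> fw b c \<and> up c d \<or> fw c b \<and> up c d \<or> fw c b \<and> fw d c"
proof -
  have "\<not> (up x y \<and> fw y z)" "\<not> (up x y \<and> fw z y)" for x y z
    using up_leaf nx_in unfolding fw_def by blast+
  moreover have "\<not> (up c b \<and> up c d)" using assms(3) by (auto simp: up_def)
  moreover have "\<not> (fw c b \<and> fw c d)" using assms(3) by (auto simp: fw_def)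
  moreover have "\<not> (fw b c \<and> fw d c)" using assms(3) fw_inj by blast
  ultimately show ?thesis using assms(1,2) unfolding adj_def by blast
qed

text \<open>Since \<open>a = e\<close> is allowed, this covers the paths and the cycles with four
  edges at once.\<close>

lemma walk_not_bichromatic:
  assumes "adj a b" "adj b c" "adj c d" "adj d e" "a \<noteq> c" "b \<noteq> d" "c \<noteq> e"
    and "col a b = col c d" "col b c = col d e"
  shows False
proof -
  have r: "adj e d" "adj d c" "adj c b" "adj b a" "e \<noteq> c" "d \<noteq> b" "c \<noteq> a"
    "col e d = col c b" "col d c = col b a"
    using assms col_commute[of a b] col_commute[of b c] col_commute[of c d] col_commute[of d e] adj_commute by auto
  note fwd = assms(1,4,5,7,8,9) and bwd = r(1,4,5,7,8,9)
  from walk_cases[OF assms(2,3,6)] show False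
    using walk_up_down[OF _ _ assms(6) fwd] walk_down_down[OF _ _ fwd] walk_down_fw[OF _ _ fwd]
      walk_down_bw[OF _ _ fwd] walk_fw_fw[OF _ _ fwd]
      walk_down_down[OF _ _ bwd] walk_down_fw[OF _ _ bwd]
      walk_down_bw[OF _ _ bwd] walk_fw_fw[OF _ _ bwd]
    by blast
qed

section \<open>Colors of adjacent edges\<close>

lemma adjacent_colors_neq_aux:
  assumes "a \<noteq> c"
  shows "up a b \<Longrightarrow> up c b \<Longrightarrow> col a b \<noteq> col b c" "up b a \<Longrightarrow> up c b \<Longrightarrow> col a b \<noteq> col b c"
    "up b a \<Longrightarrow> fw b c \<Longrightarrow> col a b \<noteq> col b c" "up b a \<Longrightarrow> fw c b \<Longrightarrow> col a b \<noteq> col b c"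
    "fw a b \<Longrightarrow> fw b c \<Longrightarrow> col a b \<noteq> col b c"
proof -
  show "up a b \<Longrightarrow> up c b \<Longrightarrow> col a b \<noteq> col b c"
    using g_sibling[of a c] assms by (auto simp: col_simps) (auto simp: up_def)
  show "up b a \<Longrightarrow> up c b \<Longrightarrow> col a b \<noteq> col b c"
    using g_par[of c] by (auto simp: col_simps) (auto simp: up_def)
  have *: "x \<in> Inc (par x)" if "x \<in> S" for x using S_X[OF that] by (simp add: Inc_def ch_def)
  show "up b a \<Longrightarrow> fw b c \<Longrightarrow> col a b \<noteq> col b c"
    using h_Inc[of b b] h_jump[of b] *[of b] by (cases "jump b") (auto simp: col_simps fw_def)
  show "up b a \<Longrightarrow> fw c b \<Longrightarrow> col a b \<noteq> col b c"
    using h_Inc[of c b] h_jump[of c] *[of b] by (cases "jump c") (auto simp: col_simps fw_def jump_def)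
  show "fw a b \<Longrightarrow> fw b c \<Longrightarrow> col a b \<noteq> col b c"
    using h_nx[of a] by (auto simp: col_simps fw_def)
qed

lemma adjacent_colors_neq:
  assumes "adj a b" "adj b c" "a \<noteq> c"
  shows "col a b \<noteq> col b c"
proof -
  have eq: "col b a = col a b" "col c b = col b c"
    using col_commute[OF assms(1)] col_commute[OF assms(2)] by simp_all
  show ?thesis
  proof
    assume e: "col a b = col b c"
    from walk_cases[OF assms] show False
      using adjacent_colors_neq_aux[OF assms(3), of b]
        adjacent_colors_neq_aux[OF assms(3)[symmetric], of b, unfolded eq] e e[symmetric] by blast
  qed
qed

end

section \<open>Paths and rooted trees\<close>

lemma path_edges_Cons_Cons:
  "path_edges (x # y # p) = insert {x, y} (path_edges (y # p))"
proof -
  have eq: "path_edges q = (\<lambda>i. {q ! i, q ! Suc i}) ` {i. Suc i < length q}" for q :: "'a list"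
    by (auto simp: path_edges_def)
  have "{i. Suc i < length (x # y # p)} = insert 0 (Suc ` {i. Suc i < length (y # p)})"
    by (auto simp: image_iff gr0_conv_Suc less_Suc_eq_0_disj)
  then show ?thesis
    unfolding eq by (simp only: image_insert image_image) simp
qed

lemma path_edges_simps [simp]:
  "path_edges [] = {}" "path_edges [x] = {}"
  "path_edges (x # y # p) = insert {x, y} (path_edges (y # p))"
  by (simp_all only: path_edges_Cons_Cons) (simp_all add: path_edges_def)

lemma path_edges_append:
  assumes "p \<noteq> []" "q \<noteq> []"
  shows "path_edges (p @ q) = path_edges p \<union> path_edges q \<union> {{last p, hd q}}"
  using assms
proof (induction p rule: induct_list012)
  case (2 x)
  then show ?case by (cases q) auto
next
  case (3 x y zs)
  then show ?case by auto
qed auto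

lemma path_edges_rev: "path_edges (rev p) = path_edges p"
proof (induction p rule: induct_list012)
  case (3 x y zs)
  then show ?case using path_edges_append[of "rev zs @ [y]" "[x]"] by (auto simp: insert_commute)
qed auto

lemma path_edges_subset: "e \<in> path_edges p \<Longrightarrow> e \<subseteq> set p"
  by (auto simp: path_edges_def)

lemma path_in_append1:
  assumes "path_in G (p @ q)" "p \<noteq> []"
  shows "path_in G p"
  using assms by (cases "q = []") (auto simp: path_in_def path_edges_append)

lemma path_in_snoc:
  assumes "path_in G p" "{last p, y} \<in> edges G" "y \<in> verts G" "y \<notin> set p"
  shows "path_in G (p @ [y])"
  using assms by (auto simp: path_in_def path_edges_append)

text \<open>Unlike \<^const>\<open>path_in\<close>, reachability as a transitive closure needs no distinctness; this
  lemma cuts out repetitions.\<close>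

lemma path_in_if_rtranclp:
  assumes "(\<lambda>a b. {a, b} \<in> edges G \<and> a \<in> W \<and> b \<in> W)\<^sup>*\<^sup>* x y" "x \<in> W" "W \<subseteq> verts G"
  shows "\<exists>p. path_in G p \<and> hd p = x \<and> last p = y \<and> set p \<subseteq> W"
  using assms(1)
proof (induction rule: rtranclp_induct)
  case base
  then show ?case using assms by (intro exI[of _ "[x]"]) (auto simp: path_in_def)
next
  case (step y z)
  then obtain p where p: "path_in G p" "hd p = x" "last p = y" "set p \<subseteq> W" by blast
  have ne: "p \<noteq> []" using p by (auto simp: path_in_def)
  show ?case
  proof (cases "z \<in> set p")
    case True
    then obtain p1 p2 where "p = (p1 @ [z]) @ p2" using split_list[of z p] by auto
    then show ?thesis using path_in_append1[of G "p1 @ [z]" p2] p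
      by (intro exI[of _ "p1 @ [z]"]) (auto simp: hd_append split: if_splits)
  next
    case False
    then show ?thesis using path_in_snoc[of G p z] p step assms(3) ne
      by (intro exI[of _ "p @ [z]"]) auto
  qed
qed

lemma rtranclp_if_path_in:
  assumes "path_in G p" "set p \<subseteq> W"
  shows "(\<lambda>a b. {a, b} \<in> edges G \<and> a \<in> W \<and> b \<in> W)\<^sup>*\<^sup>* (hd p) (last p)"
  using assms
proof (induction p rule: induct_list012)
  case (3 x y zs)
  then have "path_in G (y # zs)" "{x, y} \<in> edges G" "x \<in> W" "y \<in> W" by (auto simp: path_in_def)
  moreover from this have "(\<lambda>a b. {a, b} \<in> edges G \<and> a \<in> W \<and> b \<in> W)\<^sup>*\<^sup>* y (last (y # zs))"
    using 3 by simp
  ultimately show ?case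
    using converse_rtranclp_into_rtranclp[of "\<lambda>a b. {a, b} \<in> edges G \<and> a \<in> W \<and> b \<in> W" x y] by simp
qed (auto simp: path_in_def)

section \<open>Distances from a root and parents in a tree\<close>

lemma graph_dist_le:
  assumes "path_in G p" "hd p = u" "last p = v"
  shows "graph_dist G u v \<le> length p - 1"
  unfolding graph_dist_def
  by (rule Least_le) (use assms in \<open>auto simp: path_in_def intro!: exI[of _ p]\<close>)

lemma shortest_path:
  assumes "connected_graph G" "u \<in> verts G" "v \<in> verts G"
  obtains p where "path_in G p" "hd p = u" "last p = v" "length p = Suc (graph_dist G u v)"
proof -
  obtain p where p: "path_in G p" "hd p = u" "last p = v"
    using assms unfolding connected_graph_def by blast
  then have "\<exists>n p. path_in G p \<and> hd p = u \<and> last p = v \<and> length p = Suc n"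
    by (intro exI[of _ "length p - 1"] exI[of _ p]) (auto simp: path_in_def)
  then have "\<exists>p. path_in G p \<and> hd p = u \<and> last p = v \<and> length p = Suc (graph_dist G u v)"
    unfolding graph_dist_def by (rule LeastI_ex)
  then show ?thesis using that by blast
qed

lemma graph_dist_prefix:
  assumes "path_in G p" "i < length p"
  shows "graph_dist G (hd p) (p ! i) \<le> i"
proof -
  have "path_in G (take (Suc i) p)"
    using path_in_append1[of G "take (Suc i) p" "drop (Suc i) p"] assms by (cases p) auto
  from graph_dist_le[OF this refl refl] show ?thesis
    using assms by (simp add: hd_take) (simp add: take_Suc_conv_app_nth)
qed

lemma graph_dist_edge:
  assumes "connected_graph G" "r \<in> verts G" "x \<in> verts G" "y \<in> verts G" "{x, y} \<in> edges G"
  shows "graph_dist G r y \<le> Suc (graph_dist G r x)"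
proof -
  obtain p where p: "path_in G p" "hd p = r" "last p = x" "length p = Suc (graph_dist G r x)"
    using shortest_path assms by metis
  have ne: "p \<noteq> []" using p by (auto simp: path_in_def)
  show ?thesis
  proof (cases "y \<in> set p")
    case True
    then obtain i where "i < length p" "p ! i = y" by (auto simp: in_set_conv_nth)
    then show ?thesis using graph_dist_prefix[OF p(1), of i] p by simp
  next
    case False
    then show ?thesis using graph_dist_le[of G "p @ [y]" r y] path_in_snoc[of G p y] assms p ne by auto
  qed
qed

text \<open>A shortest path from \<open>r\<close> to \<open>y\<close> or \<open>z\<close> cannot
  pass through \<open>x\<close>, which is at least as far away. So \<open>y\<close> and
  \<open>z\<close> are connected without \<open>x\<close>, and a path between them closes to a cycle
  through \<open>x\<close>. The weak inequalities also exclude edges between vertices at equal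
  distance.\<close>

lemma tree_parent_unique:
  assumes T: "tree T" and r: "r \<in> verts T" and x: "x \<in> verts T"
    and y: "{x, y} \<in> edges T" "graph_dist T r y \<le> graph_dist T r x"
    and z: "{x, z} \<in> edges T" "graph_dist T r z \<le> graph_dist T r x"
  shows "y = z"
proof (rule ccontr)
  assume "y \<noteq> z"
  have con: "connected_graph T" and simple: "simple_graph T" using T by (auto simp: tree_def)
  let ?W = "verts T - {x}"
  let ?R = "\<lambda>a b. {a, b} \<in> edges T \<and> a \<in> ?W \<and> b \<in> ?W"
  have reach: "?R\<^sup>*\<^sup>* r w \<and> w \<in> ?W" if "{x, w} \<in> edges T" "graph_dist T r w \<le> graph_dist T r x" for w
  proof -
    have w: "w \<in> verts T" "w \<noteq> x" using that simple by (force simp: simple_graph_def)+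
    obtain p where p: "path_in T p" "hd p = r" "last p = w" "length p = Suc (graph_dist T r w)"
      using shortest_path[OF con r w(1)] .
    have "x \<notin> set p"
    proof
      assume "x \<in> set p"
      then obtain i where i: "i < length p" "p ! i = x" by (auto simp: in_set_conv_nth)
      then have "graph_dist T r x \<le> i" using graph_dist_prefix[OF p(1)] p(2) by metis
      then have "i = length p - 1" using that(2) i p(4) by auto
      then have "p ! i = w" using p(1,3) by (metis last_conv_nth path_in_def)
      then show False using i w by simp
    qed
    then show ?thesis using rtranclp_if_path_in[OF p(1), of ?W] p w by (auto simp: path_in_def)
  qed
  have "symp ?R" by (auto simp: symp_def insert_commute)
  from sympD[OF symp_rtranclp[OF this]] have "?R\<^sup>*\<^sup>* y z"
    using reach[OF y] reach[OF z] rtranclp_trans[of ?R y r z] by blast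
  then obtain p where p: "path_in T p" "hd p = y" "last p = z" "set p \<subseteq> ?W"
    using path_in_if_rtranclp[of T ?W y z] reach[OF y] by blast
  obtain p' where "p = y # p'" using p by (cases p) (auto simp: path_in_def)
  moreover have "p' \<noteq> []" using p(3) \<open>y \<noteq> z\<close> calculation by auto
  ultimately have p': "p = y # p'" "p' \<noteq> []" by auto
  have "length p' > 0" using p' by simp
  then have "cycle_in T (x # p)"
    using p p' x y z unfolding cycle_in_def cycle_edges_def path_in_def
    by (auto simp: insert_commute Suc_le_eq)
  then show False using T by (auto simp: tree_def)
qed

lemma tree_parent:
  assumes T: "tree T" and r: "r \<in> verts T"
  obtains par where
    "\<And>x. x \<in> verts T - {r} \<Longrightarrow> par x \<in> verts T"
    "\<And>x. x \<in> verts T - {r} \<Longrightarrow> graph_dist T r x = Suc (graph_dist T r (par x))"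
    "edges T = {{x, par x} | x. x \<in> verts T - {r}}"
proof -
  have con: "connected_graph T" and simple: "simple_graph T" using T by (auto simp: tree_def)
  have ex: "\<exists>y. {x, y} \<in> edges T \<and> y \<in> verts T \<and> graph_dist T r x = Suc (graph_dist T r y)"
    if x: "x \<in> verts T - {r}" for x
  proof -
    obtain p where p: "path_in T p" "hd p = r" "last p = x" "length p = Suc (graph_dist T r x)"
      using shortest_path[OF con r, of x] x by blast
    have "p \<noteq> []" using p by (auto simp: path_in_def)
    then obtain q where q: "p = q @ [x]" using p(3) by (metis append_butlast_last_id)
    have "q \<noteq> []" using q p x by auto
    then have e: "{last q, x} \<in> edges T" "path_in T q" "hd q = r" "last q \<in> verts T"
      using p q path_in_append1[of T q "[x]"] by (auto simp: path_in_def path_edges_append)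
    then have "graph_dist T r (last q) \<le> length q - 1" using graph_dist_le by metis
    moreover have "graph_dist T r x \<le> Suc (graph_dist T r (last q))"
      using graph_dist_edge[OF con r e(4) _ e(1)] x by simp
    moreover have "length q > 0" using \<open>q \<noteq> []\<close> by simp
    moreover have "graph_dist T r x = length q" using p(4) q by simp
    ultimately have "graph_dist T r x = Suc (graph_dist T r (last q))" by linarith
    then show ?thesis using e by (intro exI[of _ "last q"]) (auto simp: insert_commute)
  qed
  define par where "par x = (SOME y. {x, y} \<in> edges T \<and> y \<in> verts T \<and>
    graph_dist T r x = Suc (graph_dist T r y))" for x
  have par: "{x, par x} \<in> edges T \<and> par x \<in> verts T \<and> graph_dist T r x = Suc (graph_dist T r (par x))"
    if "x \<in> verts T - {r}" for x
    unfolding par_def by (rule someI_ex) (rule ex[OF that])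
  have r0: "graph_dist T r r = 0"
    using graph_dist_le[of T "[r]" r r] r by (auto simp: path_in_def)
  have "\<exists>x. e = {x, par x} \<and> x \<in> verts T - {r}" if e: "e \<in> edges T" for e
  proof -
    obtain x y where xy: "e = {x, y}" "x \<noteq> y" "x \<in> verts T" "y \<in> verts T"
      "graph_dist T r y \<le> graph_dist T r x"
    proof -
      obtain x y where "e = {x, y}" "x \<noteq> y" "x \<in> verts T" "y \<in> verts T"
        using e simple by (auto simp: simple_graph_def card_2_iff)
      then show ?thesis using that[of x y] that[of y x] by (metis insert_commute nle_le)
    qed
    have "x \<noteq> r"
    proof
      assume "x = r"
      then have "graph_dist T r y = 0" using xy r0 by simp
      then show False using par[of y] xy \<open>x = r\<close> by auto
    qed
    then have "y = par x"
      using tree_parent_unique[OF T r xy(3), of y "par x"] par[of x] xy e by auto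
    then show ?thesis using xy \<open>x \<noteq> r\<close> by auto
  qed
  then have "edges T = {{x, par x} | x. x \<in> verts T - {r}}" using par by blast
  with par that show ?thesis by blast
qed

section \<open>From list colorings to star edge choosability\<close>

lemma card_2_alternating:
  assumes "card {x, y, z, w} = 2" "x \<noteq> y" "y \<noteq> z" "z \<noteq> w"
  shows "x = z \<and> y = w"
proof -
  have "card {x, y} = 2" using assms(2) by simp
  then have "{x, y, z, w} = {x, y}"
    using card_subset_eq[of "{x, y, z, w}" "{x, y}"] assms(1) by auto
  then have "z \<in> {x, y}" "w \<in> {x, y}" by blast+
  then show ?thesis using assms(2-4) by auto
qed

context tree_cycle_coloring
begin

lemma star_edge_coloring_if_col:
  assumes H: "simple_graph H" "\<And>a b. {a, b} \<in> edges H \<longleftrightarrow> adj a b"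
    and \<phi>: "\<And>a b. adj a b \<Longrightarrow> \<phi> {a, b} = col a b"
  shows "star_edge_coloring H \<phi>"
proof -
  have proper: "\<phi> {a, b} \<noteq> \<phi> {b, c}" if "{a, b} \<in> edges H" "{b, c} \<in> edges H" "a \<noteq> c" for a b c
    using adjacent_colors_neq[of a b c] that H(2) \<phi> by simp
  have walk: False if "{a, b} \<in> edges H" "{b, c} \<in> edges H" "{c, d} \<in> edges H" "{d, e} \<in> edges H"
    "a \<noteq> c" "b \<noteq> d" "c \<noteq> e" "card {\<phi> {a, b}, \<phi> {b, c}, \<phi> {c, d}, \<phi> {d, e}} = 2" for a b c d e
  proof -
    have adj: "adj a b" "adj b c" "adj c d" "adj d e" using that H(2) by simp_all
    have "\<phi> {a, b} = \<phi> {c, d} \<and> \<phi> {b, c} = \<phi> {d, e}"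
      using card_2_alternating[OF that(8)] proper that by blast
    then show False using walk_not_bichromatic[OF adj that(5-7)] \<phi> adj by simp
  qed
  have "proper_edge_coloring H \<phi>"
    unfolding proper_edge_coloring_def
  proof (intro ballI impI, elim conjE)
    fix e f assume e: "e \<in> edges H" and f: "f \<in> edges H" and "e \<noteq> f" "e \<inter> f \<noteq> {}"
    then obtain b where b: "b \<in> e" "b \<in> f" by auto
    have ends: "\<exists>a. e = {a, b}" if "e \<in> edges H" "b \<in> e" for e
    proof -
      have "card e = 2" using H(1) that by (simp add: simple_graph_def)
      then obtain u v where "e = {u, v}" by (auto simp: card_2_iff)
      then show ?thesis using that(2) by (auto simp: insert_commute)
    qed
    obtain a where a: "e = {a, b}" using ends e b by blast
    obtain c where c: "f = {c, b}" using ends f b by blast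
    have "a \<noteq> c" using a c \<open>e \<noteq> f\<close> by blast
    then show "\<phi> e \<noteq> \<phi> f" using proper[of a b c] e f unfolding a c by (simp add: insert_commute)
  qed
  moreover have False if p5: "path_in H p" "length p = 5" "card (\<phi> ` path_edges p) = 2" for p
  proof -
    obtain a b c d e where p: "p = [a, b, c, d, e]"
      using p5(2) by (auto simp: length_Suc_conv numeral_eq_Suc)
    then have pe: "path_edges p = {{a, b}, {b, c}, {c, d}, {d, e}}"
      by simp
    then have "{{a, b}, {b, c}, {c, d}, {d, e}} \<subseteq> edges H" using p5(1) by (simp add: path_in_def)
    then show False using walk[of a b c d e] p5 p pe by (auto simp: path_in_def)
  qed
  moreover have False if p4: "cycle_in H p" "length p = 4" "card (\<phi> ` cycle_edges p) = 2" for p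
  proof -
    obtain a b c d where p: "p = [a, b, c, d]"
      using p4(2) by (auto simp: length_Suc_conv numeral_eq_Suc)
    then have "path_edges p = {{a, b}, {b, c}, {c, d}}"
      by simp
    then have pe: "cycle_edges p = {{a, b}, {b, c}, {c, d}, {d, a}}"
      using p by (auto simp: cycle_edges_def)
    then have "{{a, b}, {b, c}, {c, d}, {d, a}} \<subseteq> edges H" using p4(1) by (simp add: cycle_in_def)
    then show False using walk[of a b c d a] p4 p pe by (auto simp: cycle_in_def)
  qed
  ultimately show ?thesis unfolding star_edge_coloring_def by blast
qed

end

context rooted_tree_cycle_bound
begin

lemma star_edge_choosable_if_edges:
  assumes H: "simple_graph H" "edges H = {{x, par x} | x. x \<in> V - {r}} \<union> {{x, nx x} | x. x \<in> S}"
  shows "star_edge_choosable H k"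
  unfolding star_edge_choosable_def
proof (intro allI impI)
  fix L :: "'a set \<Rightarrow> nat set"
  assume L: "\<forall>e\<in>edges H. finite (L e) \<and> card (L e) \<ge> k"
  have "\<forall>x\<in>V - {r}. k \<le> card (L {x, par x})" using L H(2) by blast
  then obtain g where g:
    "\<forall>x\<in>V - {r}. g x \<in> L {x, par x}"
    "\<forall>x\<in>V - {r}. \<forall>y\<in>V - {r}. par x = par y \<longrightarrow> x \<noteq> y \<longrightarrow> g x \<noteq> g y"
    "\<forall>x\<in>V - {r}. par x \<noteq> r \<longrightarrow> g x \<noteq> g (par x)"
    "\<forall>x\<in>V - {r}. \<forall>y\<in>V - {r}. par x \<noteq> r \<longrightarrow> par y \<noteq> r \<longrightarrow> par x \<noteq> par y \<longrightarrow>
       par (par x) = par (par y) \<longrightarrow> \<not> (g x = g (par y) \<and> g y = g (par x))"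
    "\<forall>y\<in>V - {r}. par y \<noteq> r \<longrightarrow> par (par y) \<noteq> r \<longrightarrow>
       (\<forall>z\<in>Inc (par (par (par y))). z \<noteq> par (par y) \<longrightarrow> \<not> (g y = g (par (par y)) \<and> g (par y) = g z))"
    "\<forall>x\<in>S. jump x \<longrightarrow> g x \<noteq> g (nx x)"
    by (rule tree_coloring)
  have "\<forall>x\<in>S. finite (L {x, nx x}) \<and> k \<le> card (L {x, nx x})" using L H(2) by blast
  then obtain h where h:
    "\<forall>x\<in>S. h x \<in> L {x, nx x}" "\<forall>x\<in>S. h x \<noteq> h (nx x)"
    "\<forall>x\<in>S. \<not> jump x \<longrightarrow> (\<forall>z\<in>Inc (par x). h x \<noteq> g z) \<and>
      (jump (pv x) \<longrightarrow> h x \<noteq> g (pv x)) \<and> (jump (nx x) \<longrightarrow> h x \<noteq> g (nx (nx x)))"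
    "\<forall>x\<in>S. jump x \<longrightarrow> h x \<notin> {g x, g (nx x), g (par x), g (par (nx x))} \<and>
      (\<forall>y\<in>S. jump y \<longrightarrow> par (nx y) = par x \<longrightarrow> h x \<noteq> g (nx y))"
    "\<forall>x\<in>S. h x = h (nx (nx x)) \<longrightarrow> jump x \<and> jump (nx (nx x))"
    by (rule cycle_coloring[where g = g])
  interpret tree_cycle_coloring V r par dep S nx g h
  proof (unfold_locales, goal_cases)
    case (1 x y) then show ?case using g(2) by blast
  next
    case (2 x) then show ?case using g(3) by blast
  next
    case (3 x y) then show ?case using bspec[OF bspec[OF g(4) 3(1)] 3(2)] by blast
  next
    case (4 y z) then show ?case using bspec[OF g(5) 4(1)] by blast
  next
    case (5 x) then show ?case using g(6) by blast
  next
    case (6 x) then show ?case using h(2) by blast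
  next
    case (7 x z) then show ?case using bspec[OF h(3) 7(1)] by blast
  next
    case (8 x) then show ?case using bspec[OF h(3) 8(1)] by blast
  next
    case (9 x) then show ?case using bspec[OF h(3) 9(1)] by blast
  next
    case (10 x) then show ?case using bspec[OF h(4) 10(1)] by blast
  next
    case (11 x y) then show ?case using bspec[OF h(4) 11(1)] by blast
  next
    case (12 x) then show ?case using h(5) by blast
  qed
  have edge: "{a, b} \<in> edges H \<longleftrightarrow> adj a b" for a b
    unfolding H(2) adj_def up_def fw_def by (auto simp: doubleton_eq_iff)
  \<comment> \<open>An edge does not remember its orientation; \<open>col_commute\<close> makes the
    chosen value independent of it.\<close>
  define \<phi> where "\<phi> e = (SOME c. \<exists>a b. e = {a, b} \<and> adj a b \<and> c = col a b)" for e
  have \<phi>: "\<phi> {a, b} = col a b" if "adj a b" for a b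
    unfolding \<phi>_def by (rule some_equality) (use that col_commute in \<open>auto simp: doubleton_eq_iff\<close>)
  have "star_edge_coloring H \<phi>" using H(1) edge \<phi> by (rule star_edge_coloring_if_col)
  moreover have "\<phi> e \<in> L e" if "e \<in> edges H" for e
  proof -
    from that consider x where "x \<in> V - {r}" "e = {x, par x}" | x where "x \<in> S" "e = {x, nx x}"
      unfolding H(2) by blast
    then show ?thesis
    proof cases
      case (1 x)
      then have "up x (par x)" by (simp add: up_def)
      then show ?thesis using 1 g(1) \<phi>[of x "par x"] by (simp add: adj_def col_up)
    next
      case (2 x)
      then have "fw x (nx x)" by (simp add: fw_def)
      then show ?thesis using 2 h(1) \<phi>[of x "nx x"] by (simp add: adj_def col_fw)
    qed
  qed
  ultimately show "\<exists>\<phi>. star_edge_coloring H \<phi> \<and> (\<forall>e\<in>edges H. \<phi> e \<in> L e)" by blast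
qed

end

section \<open>Planarity\<close>

text \<open>Arcs of different edges meet only in common vertices, and the vertices of a path are
  distinct, so joining the arcs one by one creates no self-intersection. Single arcs may have to be
  reversed to fit the direction of the path.\<close>

lemma plane_path_arc:
  assumes emb: "plane_embedding G pos \<gamma>" and "path_in G p" "2 \<le> length p"
  shows "\<exists>c. arc c \<and> pathstart c = pos (hd p) \<and> pathfinish c = pos (last p) \<and>
    path_image c = (\<Union>e\<in>path_edges p. path_image (\<gamma> e))"
  using assms(2,3)
proof (induction p rule: induct_list012)
  case (3 x y q)
  have e: "{x, y} \<in> edges G" and xy: "x \<in> verts G" "y \<in> verts G" "x \<noteq> y"
    using 3 by (auto simp: path_in_def)
  have \<gamma>: "arc (\<gamma> {x, y})" "{pathstart (\<gamma> {x, y}), pathfinish (\<gamma> {x, y})} = {pos x, pos y}"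
    using emb e unfolding plane_embedding_def by fastforce+
  have "\<exists>c. arc c \<and> pathstart c = pos x \<and> pathfinish c = pos y \<and> path_image c = path_image (\<gamma> {x, y})"
  proof (cases "pathstart (\<gamma> {x, y}) = pos x")
    case True
    then show ?thesis using \<gamma> by (intro exI[of _ "\<gamma> {x, y}"]) (auto simp: doubleton_eq_iff)
  next
    case False
    then show ?thesis using \<gamma>
      by (intro exI[of _ "reversepath (\<gamma> {x, y})"]) (auto simp: doubleton_eq_iff arc_reversepath)
  qed
  then obtain c where c: "arc c" "pathstart c = pos x" "pathfinish c = pos y"
    "path_image c = path_image (\<gamma> {x, y})" by blast
  show ?case
  proof (cases "q = []")
    case True
    then show ?thesis using c by (intro exI[of _ c]) auto
  next
    case False
    have "path_in G (y # q)" using 3 by (auto simp: path_in_def)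
    moreover have "2 \<le> length (y # q)" using False by (cases q) auto
    ultimately obtain d where d: "arc d" "pathstart d = pos y" "pathfinish d = pos (last (y # q))"
      "path_image d = (\<Union>e\<in>path_edges (y # q). path_image (\<gamma> e))"
      using 3(2) by auto
    have "path_image c \<inter> path_image d \<subseteq> {pos y}"
    proof
      fix z assume "z \<in> path_image c \<inter> path_image d"
      then obtain f where f: "f \<in> path_edges (y # q)" "z \<in> path_image (\<gamma> {x, y}) \<inter> path_image (\<gamma> f)"
        using c d by auto
      have "x \<notin> f" using path_edges_subset[OF f(1)] 3(3) by (auto simp: path_in_def)
      moreover have "f \<in> edges G" using f(1) 3(3) by (auto simp: path_in_def)
      moreover from calculation have "{x, y} \<noteq> f" by auto
      ultimately have "z \<in> pos ` ({x, y} \<inter> f)" using emb e f(2) unfolding plane_embedding_def by metis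
      then show "z \<in> {pos y}" using \<open>x \<notin> f\<close> by auto
    qed
    then have "arc (c +++ d)" using c d by (intro arc_join) auto
    then show ?thesis using c d by (intro exI[of _ "c +++ d"]) (auto simp: path_image_join)
  qed
qed auto

lemma plane_edges_inter:
  assumes emb: "plane_embedding G pos \<gamma>" and "E \<subseteq> edges G" "F \<subseteq> edges G" "E \<inter> F = {}"
  shows "(\<Union>e\<in>E. path_image (\<gamma> e)) \<inter> (\<Union>e\<in>F. path_image (\<gamma> e)) \<subseteq> pos ` (\<Union>E \<inter> \<Union>F)"
proof
  fix z assume "z \<in> (\<Union>e\<in>E. path_image (\<gamma> e)) \<inter> (\<Union>e\<in>F. path_image (\<gamma> e))"
  then obtain e f where ef: "e \<in> E" "f \<in> F" "z \<in> path_image (\<gamma> e) \<inter> path_image (\<gamma> f)" by auto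
  then have "e \<noteq> f" "e \<in> edges G" "f \<in> edges G" using assms by auto
  then have "z \<in> pos ` (e \<inter> f)" using emb ef unfolding plane_embedding_def by metis
  then show "z \<in> pos ` (\<Union>E \<inter> \<Union>F)" using ef by auto
qed

lemma Union_path_edges: "\<Union>(path_edges p) \<subseteq> set p"
  using path_edges_subset by fastforce

text \<open>If \<open>outside J\<close> were larger, this connected set would meet both
  \<open>outside D\<close> and its complement, hence also the frontier \<open>J\<close>, from which
  it is disjoint. It serves to show that everything drawn off the outer cycle lies inside
  it.\<close>

lemma outside_eq_if_frontier_eq:
  fixes D J :: "complex set"
  assumes "bounded D" "J \<subseteq> D" "frontier (outside D) = J"
  shows "outside J = outside D"
proof (rule ccontr)
  assume "outside J \<noteq> outside D"
  moreover have sub: "outside D \<subseteq> outside J" using assms(2) by (rule outside_mono)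
  ultimately have "outside J - outside D \<noteq> {}" by auto
  moreover have "outside J \<inter> outside D \<noteq> {}"
    using sub outside_bounded_nonempty[OF assms(1)] by auto
  moreover have "connected (outside J)"
    using bounded_subset[OF assms(1,2)] by (intro connected_outside) auto
  ultimately have "outside J \<inter> J \<noteq> {}" using connected_Int_frontier assms(3) by metis
  then show False by simp
qed

text \<open>The chord \<open>c\<close> splits the inside of the closed curve into two parts, the boundary of each
  of which misses one end of \<open>q\<close>.\<close>

lemma chords_cross:
  fixes c1 c2 c q :: "real \<Rightarrow> complex"
  assumes "arc c1" "pathstart c1 = a" "pathfinish c1 = b"
    and "arc c2" "pathstart c2 = a" "pathfinish c2 = b"
    and "arc c" "pathstart c = a" "pathfinish c = b"
    and int: "path_image c1 \<inter> path_image c2 = {a, b}" "path_image c1 \<inter> path_image c = {a, b}"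
      "path_image c2 \<inter> path_image c = {a, b}"
    and "path_image c \<inter> inside (path_image c1 \<union> path_image c2) \<noteq> {}"
    and q: "arc q" "pathstart q \<in> path_image c1 - {a, b}" "pathfinish q \<in> path_image c2 - {a, b}"
    and q_in: "path_image q - {pathstart q, pathfinish q} \<subseteq> inside (path_image c1 \<union> path_image c2)"
    and qc: "path_image q \<inter> path_image c = {}"
  shows False
proof -
  let ?Q = "path_image q - {pathstart q, pathfinish q}"
  let ?J = "path_image c1 \<union> path_image c2"
  let ?I1 = "inside (path_image c1 \<union> path_image c)"
  let ?I2 = "inside (path_image c2 \<union> path_image c)"
  have "a \<noteq> b" using assms(1-3) arc_distinct_ends by metis
  have simple: "simple_path c1" "simple_path c2" "simple_path c"
    using assms(1,4,7) by (auto intro: arc_imp_simple_path)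
  from split_inside_simple_closed_curve[OF simple(1) assms(2,3) simple(2) assms(5,6) simple(3)
      assms(8,9) \<open>a \<noteq> b\<close> int assms(13)]
  have dis: "?I1 \<inter> ?I2 = {}" and cov: "?I1 \<union> ?I2 \<union> (path_image c - {a, b}) = inside ?J"
    by auto
  have closed: "closed (path_image c1 \<union> path_image c)" "closed (path_image c2 \<union> path_image c)"
    using assms arc_imp_path closed_path_image by (metis closed_Un)+
  have "?Q \<subseteq> ?I1 \<union> ?I2" using cov q_in qc by blast
  moreover have "connected ?Q" by (rule connected_simple_path_endless) (use q arc_imp_simple_path in auto)
  moreover have "open ?I1" "open ?I2" using closed open_inside by auto
  ultimately have Q: "?Q \<subseteq> ?I1 \<or> ?Q \<subseteq> ?I2"
    using dis connectedD[of ?Q ?I1 ?I2] by blast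
  \<comment> \<open>Deleting its two ends does not shrink the closure of an arc, because a connected
    set with more than one point has no isolated point. So both ends of \<open>q\<close> lie in the
    closure of the same part.\<close>
  have lim: "z \<in> closure ?Q" if "z \<in> path_image q" for z
  proof -
    have "connected (path_image q)" using q arc_imp_path by (intro connected_path_image) auto
    moreover have "path_image q \<noteq> {x}" for x
      using arc_distinct_ends[OF q(1)] pathstart_in_path_image[of q] pathfinish_in_path_image[of q] by auto
    ultimately have "z islimpt path_image q" using connected_imp_perfect that by blast
    moreover have "path_image q \<subseteq> insert (pathstart q) (insert (pathfinish q) ?Q)" by auto
    ultimately have "z islimpt ?Q" by (metis islimpt_insert islimpt_subset)
    then show ?thesis by (simp add: closure_def)
  qed
  have in1: "closure ?I1 \<subseteq> path_image c1 \<union> path_image c \<union> inside ?J"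
    using closure_inside_subset[OF closed(1)] cov by blast
  have in2: "closure ?I2 \<subseteq> path_image c2 \<union> path_image c \<union> inside ?J"
    using closure_inside_subset[OF closed(2)] cov by blast
  have not_in: "z \<notin> inside ?J" if "z \<in> ?J" for z
    using that inside_no_overlap[of ?J] by blast
  from Q show False
  proof
    assume "?Q \<subseteq> ?I1"
    then have "pathfinish q \<in> closure ?I1"
      using lim[OF pathfinish_in_path_image] closure_mono by blast
    then show False using in1 q(3) int qc not_in[of "pathfinish q"] by blast
  next
    assume "?Q \<subseteq> ?I2"
    then have "pathstart q \<in> closure ?I2"
      using lim[OF pathstart_in_path_image] closure_mono by blast
    then show False using in2 q(2) int qc not_in[of "pathstart q"] by blast
  qed
qed

text \<open>The path through \<open>a\<close>, \<open>v\<close>, \<open>c\<close> is a chord of the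
  outer cycle that separates \<open>b\<close> from \<open>d\<close>. The path \<open>q\<close> has
  no vertex in common with it and so, in a plane embedding, no point.\<close>

lemma outer_cycle_noncrossing:
  assumes emb: "plane_embedding H pos \<gamma>" and H: "simple_graph H"
    and front: "frontier (outside (drawing pos \<gamma> H)) = drawing pos \<gamma> C"
    and C: "edges C \<subseteq> edges H" "verts C \<subseteq> verts H"
    and ps: "verts C = set ps" "edges C = cycle_edges ps" "distinct ps" "ps = a # A @ c # B"
    and b: "b \<in> set A" and d: "d \<in> set B"
    and v: "v \<in> verts H - verts C" "{a, v} \<in> edges H" "{v, c} \<in> edges H"
    and q: "path_in H q" "hd q = b" "last q = d" "set q \<inter> verts C = {b, d}" "v \<notin> set q"
      "path_edges q \<inter> edges C = {}"
  shows False
proof -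
  let ?im = "\<lambda>E. \<Union>e\<in>E. path_image (\<gamma> e)"
  have inj: "inj_on pos (verts H)" using emb by (auto simp: plane_embedding_def)
  have \<gamma>: "path_image (\<gamma> e) \<inter> pos ` verts H = pos ` e" "arc (\<gamma> e)" if "e \<in> edges H" for e
    using emb that by (auto simp: plane_embedding_def)
  have sub: "e \<subseteq> verts H" "card e = 2" if "e \<in> edges H" for e
    using H that by (auto simp: simple_graph_def)
  have fin: "finite (edges H)" using H sub finite_subset[of "edges H" "Pow (verts H)"]
    by (auto simp: simple_graph_def)
  define p1 where "p1 = a # A @ [c]"
  define p2 where "p2 = a # rev B @ [c]"
  define p0 where "p0 = [a, v, c]"
  have "path_edges ps = path_edges p1 \<union> path_edges (c # B)"
  proof -
    have "ps = p1 @ B" using ps(4) p1_def by simp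
    then show ?thesis using path_edges_append[of p1 B] d
      by (cases B) (auto simp: p1_def)
  qed
  moreover have "path_edges p2 = path_edges (c # B) \<union> {{last ps, hd ps}}"
  proof -
    have "rev p2 = (c # B) @ [a]" by (simp add: p2_def)
    then have "path_edges p2 = path_edges (c # B) \<union> {{last (c # B), a}}"
      using path_edges_append[of "c # B" "[a]"] path_edges_rev[of p2] by auto
    moreover have "last (c # B) = last ps" "hd ps = a" using ps(4) by auto
    ultimately show ?thesis by simp
  qed
  ultimately have EC: "edges C = path_edges p1 \<union> path_edges p2"
    using ps(2) by (auto simp: cycle_edges_def)
  have set1: "set p1 = {a, c} \<union> set A" and set2: "set p2 = {a, c} \<union> set B"
    by (auto simp: p1_def p2_def)
  have acH: "a \<in> verts H" "c \<in> verts H" "v \<in> verts H" "a \<noteq> v" "c \<noteq> v" "a \<noteq> c"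
    using ps C v by auto
  have path1: "path_in H p1" and path2: "path_in H p2"
    using ps C EC by (auto simp: path_in_def p1_def p2_def)
  have path0: "path_in H p0" using acH v by (auto simp: path_in_def p0_def)
  have path_sub: "path_edges p \<subseteq> edges H" if "path_in H p" for p using that by (auto simp: path_in_def)
  have "A \<noteq> []" "B \<noteq> []" using b d by auto
  obtain c1 where c1: "arc c1" "pathstart c1 = pos a" "pathfinish c1 = pos c" "path_image c1 = ?im (path_edges p1)"
    using plane_path_arc[OF emb path1] by (auto simp: p1_def)
  obtain c2 where c2: "arc c2" "pathstart c2 = pos a" "pathfinish c2 = pos c" "path_image c2 = ?im (path_edges p2)"
    using plane_path_arc[OF emb path2] by (auto simp: p2_def)
  obtain c0 where c0: "arc c0" "pathstart c0 = pos a" "pathfinish c0 = pos c" "path_image c0 = ?im (path_edges p0)"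
    using plane_path_arc[OF emb path0] by (auto simp: p0_def)
  have "b \<noteq> d" using ps b d by auto
  then have "2 \<le> length q" using q by (cases q; cases "tl q") (auto simp: path_in_def)
  then obtain c3 where c3: "arc c3" "pathstart c3 = pos b" "pathfinish c3 = pos d" "path_image c3 = ?im (path_edges q)"
    using plane_path_arc[OF emb q(1)] q by auto
  have mem: "pos x \<in> ?im E \<longleftrightarrow> x \<in> \<Union>E" if "x \<in> verts H" "E \<subseteq> edges H" for x E
  proof -
    have "pos x \<in> path_image (\<gamma> e) \<longleftrightarrow> x \<in> e" if "e \<in> E" for e
      using \<gamma>(1)[of e] that \<open>x \<in> verts H\<close> \<open>E \<subseteq> edges H\<close> sub(1)[of e] inj
      by (smt (verit) IntD1 IntI image_eqI inj_on_image_mem_iff subsetD)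
    then show ?thesis by auto
  qed
  have no_ac: "{a, c} \<notin> path_edges p1"
  proof -
    have "path_edges p1 = path_edges (a # A) \<union> {{last A, c}}"
      using path_edges_append[of "a # A" "[c]"] \<open>A \<noteq> []\<close> by (simp add: p1_def)
    moreover have "{a, c} \<notin> path_edges (a # A)" using path_edges_subset[of "{a, c}" "a # A"] ps by auto
    moreover have "last A \<in> set A" using \<open>A \<noteq> []\<close> by simp
    ultimately show ?thesis using ps by (auto simp: doubleton_eq_iff)
  qed
  \<comment> \<open>An edge on both sides of the cycle could only be \<open>{a, c}\<close>, which is
    no edge of \<open>p1\<close> because \<open>A\<close> is nonempty.\<close>
  have disj12: "path_edges p1 \<inter> path_edges p2 = {}"
  proof (rule ccontr)
    assume "path_edges p1 \<inter> path_edges p2 \<noteq> {}"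
    then obtain e where e: "e \<in> path_edges p1" "e \<in> path_edges p2" by auto
    then have "e \<subseteq> set p1 \<inter> set p2" using path_edges_subset by blast
    moreover have "set p1 \<inter> set p2 = {a, c}" using set1 set2 ps by auto
    ultimately have "e \<subseteq> {a, c}" by simp
    moreover have "card e = 2" using e path1 sub by (auto simp: path_in_def)
    ultimately have "e = {a, c}" using acH by (intro card_subset_eq) auto
    then show False using e no_ac by simp
  qed
  have E0: "path_edges p0 = {{a, v}, {v, c}}" by (simp add: p0_def)
  have eC: "e \<subseteq> verts C" if "e \<in> edges C" for e
  proof -
    have "e \<subseteq> set p1 \<union> set p2" using that EC path_edges_subset by blast
    then show ?thesis using set1 set2 ps by auto
  qed
  have disjC0: "edges C \<inter> path_edges p0 = {}" using eC v E0 by auto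
  have U1: "\<Union>(path_edges p1) \<subseteq> {a, c} \<union> set A" and U2: "\<Union>(path_edges p2) \<subseteq> {a, c} \<union> set B"
    and U0: "\<Union>(path_edges p0) = {a, c, v}" and Uq: "\<Union>(path_edges q) \<subseteq> set q"
    using Union_path_edges[of p1] Union_path_edges[of p2] Union_path_edges[of q] set1 set2 E0 by auto
  have ends: "{pos a, pos c} \<subseteq> path_image c1" "{pos a, pos c} \<subseteq> path_image c2" "{pos a, pos c} \<subseteq> path_image c0"
    using pathstart_in_path_image[of c1] pathfinish_in_path_image[of c1]
      pathstart_in_path_image[of c2] pathfinish_in_path_image[of c2]
      pathstart_in_path_image[of c0] pathfinish_in_path_image[of c0]
    unfolding c1(2,3) c2(2,3) c0(2,3) by (simp_all only: insert_subset empty_subsetI simp_thms)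
  have int12: "path_image c1 \<inter> path_image c2 = {pos a, pos c}"
  proof -
    have *: "path_image c1 \<inter> path_image c2 \<subseteq> pos ` (\<Union>(path_edges p1) \<inter> \<Union>(path_edges p2))"
      unfolding c1 c2 by (rule plane_edges_inter[OF emb path_sub[OF path1] path_sub[OF path2] disj12])
    have "({a, c} \<union> set A) \<inter> ({a, c} \<union> set B) = {a, c}" using ps v by auto
    then have "\<Union>(path_edges p1) \<inter> \<Union>(path_edges p2) \<subseteq> {a, c}" using U1 U2 by blast
    with * have "path_image c1 \<inter> path_image c2 \<subseteq> pos ` {a, c}" by blast
    then show ?thesis using ends by blast
  qed
  have int10: "path_image c1 \<inter> path_image c0 = {pos a, pos c}"
  proof -
    have *: "path_image c1 \<inter> path_image c0 \<subseteq> pos ` (\<Union>(path_edges p1) \<inter> \<Union>(path_edges p0))"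
      unfolding c1 c0 by (rule plane_edges_inter[OF emb]) (use path_sub path1 path0 disjC0 EC in auto)
    have "({a, c} \<union> set A) \<inter> {a, c, v} = {a, c}" using ps v by auto
    then have "\<Union>(path_edges p1) \<inter> \<Union>(path_edges p0) \<subseteq> {a, c}" using U1 U0 by blast
    with * have "path_image c1 \<inter> path_image c0 \<subseteq> pos ` {a, c}" by blast
    then show ?thesis using ends by blast
  qed
  have int20: "path_image c2 \<inter> path_image c0 = {pos a, pos c}"
  proof -
    have *: "path_image c2 \<inter> path_image c0 \<subseteq> pos ` (\<Union>(path_edges p2) \<inter> \<Union>(path_edges p0))"
      unfolding c2 c0 by (rule plane_edges_inter[OF emb]) (use path_sub path2 path0 disjC0 EC in auto)
    have "({a, c} \<union> set B) \<inter> {a, c, v} = {a, c}" using ps v by auto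
    then have "\<Union>(path_edges p2) \<inter> \<Union>(path_edges p0) \<subseteq> {a, c}" using U2 U0 by blast
    with * have "path_image c2 \<inter> path_image c0 \<subseteq> pos ` {a, c}" by blast
    then show ?thesis using ends by blast
  qed
  let ?D = "drawing pos \<gamma> H" and ?J = "path_image c1 \<union> path_image c2"
  have J_im: "?J = ?im (edges C)" using c1 c2 EC by auto
  have UC: "\<Union>(edges C) = verts C"
  proof
    show "\<Union>(edges C) \<subseteq> verts C" using eC by auto
    have in_path: "x \<in> \<Union>(path_edges p)" if "x \<in> set p" "2 \<le> length p" for x and p :: "'a list"
      using that by (induction p rule: induct_list012) (auto, case_tac zs, auto)
    have "set p1 \<subseteq> \<Union>(path_edges p1)" "set p2 \<subseteq> \<Union>(path_edges p2)"
      using in_path[of _ p1] in_path[of _ p2] by (auto simp: p1_def p2_def)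
    then show "verts C \<subseteq> \<Union>(edges C)" using EC set1 set2 ps by auto
  qed
  have JC: "drawing pos \<gamma> C = ?J"
  proof -
    have "pos ` verts C \<subseteq> ?J"
      using mem[of _ "edges C"] C UC J_im by auto
    then show ?thesis using J_im by (auto simp: drawing_def)
  qed
  have "bounded ?D"
  proof -
    have "finite (verts H)" using H by (simp add: simple_graph_def)
    then show ?thesis using fin \<gamma>(2)
      by (auto simp: drawing_def finite_imp_bounded arc_imp_path bounded_path_image intro!: bounded_UN)
  qed
  moreover have "?J \<subseteq> ?D" unfolding J_im drawing_def using C by blast
  \<comment> \<open>Here it matters that the exterior face is bounded by the outer cycle: the chord
    and \<open>q\<close> are both forced into its inside.\<close>
  ultimately have "outside ?J = outside ?D" using outside_eq_if_frontier_eq front JC by metis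
  then have inside: "z \<in> inside ?J" if "z \<in> ?D" "z \<notin> ?J" for z
    using that inside_Un_outside[of ?J] outside_no_overlap[of ?D] by blast
  have im_D: "?im (path_edges p) \<subseteq> ?D" if "path_in H p" for p
    using path_sub[OF that] by (auto simp: drawing_def)
  have "pos v \<in> path_image c0" using mem[of v "path_edges p0"] acH path_sub[OF path0] U0 c0 by auto
  moreover have "pos v \<notin> ?J" using mem[of v "edges C"] acH C UC v J_im by auto
  ultimately have ne: "path_image c0 \<inter> inside ?J \<noteq> {}"
    using inside[of "pos v"] im_D[OF path0] c0 by auto
  have bd: "b \<in> verts H" "d \<in> verts H" "b \<in> set p1" "d \<in> set p2" "b \<notin> {a, c}" "d \<notin> {a, c}"
    using b d ps C set1 set2 by auto
  have b1: "pos b \<in> path_image c1 - {pos a, pos c}" and d2: "pos d \<in> path_image c2 - {pos a, pos c}"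
  proof -
    have "b \<in> \<Union>(edges C)" "d \<in> \<Union>(edges C)" using UC ps b d by auto
    moreover have "b \<notin> \<Union>(path_edges p2)" "d \<notin> \<Union>(path_edges p1)" using U1 U2 b d ps by auto
    ultimately have "b \<in> \<Union>(path_edges p1)" "d \<in> \<Union>(path_edges p2)" using EC by auto
    then have "pos b \<in> path_image c1" "pos d \<in> path_image c2"
      using mem bd path_sub path1 path2 c1 c2 by auto
    moreover have "pos b \<notin> {pos a, pos c}" "pos d \<notin> {pos a, pos c}"
      using bd acH inj by (auto simp: inj_on_def)
    ultimately show "pos b \<in> path_image c1 - {pos a, pos c}" "pos d \<in> path_image c2 - {pos a, pos c}"
      by auto
  qed
  have "path_image c3 \<inter> ?J \<subseteq> pos ` (\<Union>(path_edges q) \<inter> \<Union>(edges C))"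
    unfolding c3 J_im by (rule plane_edges_inter[OF emb]) (use path_sub q C in auto)
  also have "\<dots> \<subseteq> {pos b, pos d}" using Uq UC q(4) by auto
  finally have q_in: "path_image c3 - {pathstart c3, pathfinish c3} \<subseteq> inside ?J"
    using inside im_D[OF q(1)] c3 by auto
  have c30: "path_image c3 \<inter> path_image c0 \<subseteq> pos ` (\<Union>(path_edges q) \<inter> \<Union>(path_edges p0))"
    unfolding c3 c0
  proof (rule plane_edges_inter[OF emb])
    show "path_edges q \<inter> path_edges p0 = {}" using E0 q(5) path_edges_subset[of _ q] by blast
  qed (use path_sub q path0 in auto)
  have "a \<in> verts C" "c \<in> verts C" using ps by auto
  moreover have "x \<notin> set q" if "x \<in> verts C" "x \<notin> {b, d}" for x using q(4) that by blast
  ultimately have "{a, c, v} \<inter> set q = {}" using q(5) bd(5,6) by auto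
  then have "\<Union>(path_edges q) \<inter> \<Union>(path_edges p0) = {}" using Uq U0 by blast
  then have qc: "path_image c3 \<inter> path_image c0 = {}" using c30 by simp
  show False
    by (rule chords_cross[OF c1(1-3) c2(1-3) c0(1-3) int12 int10 int20 ne c3(1) _ _ q_in qc])
      (simp_all only: c3(2,3) b1 d2)
qed

section \<open>Intervals of leaves on the cycle\<close>

text \<open>The cyclic successor, found by reading on from \<open>x\<close> around the list until
  \<open>x\<close> comes back. Written like this it depends only on the cyclic order, so the list
  may be rotated freely.\<close>

definition succ_in :: "'a list \<Rightarrow> 'a \<Rightarrow> 'a" where
  "succ_in ps x = hd (tl (dropWhile (\<lambda>z. z \<noteq> x) ps) @ takeWhile (\<lambda>z. z \<noteq> x) ps @ [x])"

lemma succ_in_split: "x \<notin> set U \<Longrightarrow> succ_in (U @ x # W) x = hd (W @ U @ [x])"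
proof -
  assume "x \<notin> set U"
  then have "dropWhile (\<lambda>z. z \<noteq> x) (U @ x # W) = x # W" "takeWhile (\<lambda>z. z \<noteq> x) (U @ x # W) = U"
    by (auto simp: dropWhile_append takeWhile_append)
  then show ?thesis by (simp add: succ_in_def)
qed

lemma succ_in_rotate:
  assumes "distinct (U @ W)" "x \<in> set (U @ W)"
  shows "succ_in (W @ U) x = succ_in (U @ W) x"
proof (cases "x \<in> set U")
  case True
  then obtain U1 U2 where U: "U = U1 @ x # U2" by (meson split_list)
  then have "x \<notin> set (W @ U1)" "x \<notin> set U1" using assms by auto
  then have "succ_in (W @ U) x = hd (U2 @ W @ U1 @ [x])" "succ_in (U @ W) x = hd (U2 @ W @ U1 @ [x])"
    using succ_in_split[of x "W @ U1" U2] succ_in_split[of x U1 "U2 @ W"] U by simp_all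
  then show ?thesis by simp
next
  case False
  then have "x \<in> set W" using assms by simp
  then obtain W1 W2 where W: "W = W1 @ x # W2" by (meson split_list)
  then have "x \<notin> set (U @ W1)" "x \<notin> set W1" using assms by auto
  then have "succ_in (W @ U) x = hd (W2 @ U @ W1 @ [x])" "succ_in (U @ W) x = hd (W2 @ U @ W1 @ [x])"
    using succ_in_split[of x "U @ W1" W2] succ_in_split[of x W1 "W2 @ U"] W by simp_all
  then show ?thesis by simp
qed

lemma cycle_edges_rotate: "cycle_edges (W @ U) = cycle_edges (U @ W)"
proof (cases "U = [] \<or> W = []")
  case False
  then show ?thesis by (auto simp: cycle_edges_def path_edges_append)
qed auto

text \<open>Rotating the list so that it starts at \<open>x\<close> exposes the two open arcs
  \<open>A\<close> and \<open>B\<close> between \<open>x\<close> and \<open>y\<close>. The last two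
  facts place the predecessor of \<open>x\<close> outside \<open>A\<close> and that of
  \<open>y\<close> outside \<open>B\<close>.\<close>

lemma cycle_split:
  assumes "distinct ps" "x \<in> set ps" "y \<in> set ps" "x \<noteq> y"
  obtains A B where "distinct (x # A @ y # B)" "set (x # A @ y # B) = set ps"
    "cycle_edges (x # A @ y # B) = cycle_edges ps"
    "succ_in ps x = hd (A @ [y])" "succ_in ps y = hd (B @ [x])"
    "\<And>z. z \<in> set A \<Longrightarrow> succ_in ps z \<noteq> x" "\<And>z. z \<in> set B \<Longrightarrow> succ_in ps z \<noteq> y"
proof -
  obtain U W where ps: "ps = U @ x # W" using assms by (meson split_list)
  then have "y \<in> set (W @ U)" using assms by auto
  then obtain A B where AB: "W @ U = A @ y # B" by (meson split_list)
  define qs where "qs = x # A @ y # B"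
  have qs: "qs = (x # W) @ U" using AB by (simp add: qs_def)
  have d: "distinct qs" and set: "set qs = set ps" using assms(1) unfolding qs ps by auto
  have succ: "succ_in ps z = succ_in qs z" if "z \<in> set ps" for z
    using succ_in_rotate[of U "x # W" z] that assms(1) unfolding qs ps by auto
  have A: "succ_in ps z \<noteq> x" if z: "z \<in> set A" for z
  proof -
    obtain A1 A2 where "A = A1 @ z # A2" using z by (meson split_list)
    then have "qs = (x # A1) @ z # (A2 @ y # B)" by (simp add: qs_def)
    moreover from this have "z \<notin> set (x # A1)" using d by auto
    ultimately have "succ_in qs z = hd (A2 @ y # B @ x # A1 @ [z])"
      using succ_in_split[of z "x # A1" "A2 @ y # B"] by simp
    then have "succ_in qs z \<in> set A2 \<union> {y}" by (cases A2) auto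
    moreover have "x \<notin> set A2 \<union> {y}" using d \<open>A = _\<close> by (auto simp: qs_def)
    moreover have "z \<in> set ps" using z unfolding set[symmetric] qs_def by simp
    ultimately show ?thesis using succ[of z] by auto
  qed
  have B: "succ_in ps z \<noteq> y" if z: "z \<in> set B" for z
  proof -
    obtain B1 B2 where "B = B1 @ z # B2" using z by (meson split_list)
    then have "qs = (x # A @ y # B1) @ z # B2" by (simp add: qs_def)
    moreover from this have "z \<notin> set (x # A @ y # B1)" using d by auto
    ultimately have "succ_in qs z = hd (B2 @ x # A @ y # B1 @ [z])"
      using succ_in_split[of z "x # A @ y # B1" B2] by simp
    then have "succ_in qs z \<in> set B2 \<union> {x}" by (cases B2) auto
    moreover have "y \<notin> set B2 \<union> {x}" using d \<open>B = _\<close> by (auto simp: qs_def)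
    moreover have "z \<in> set ps" using z unfolding set[symmetric] qs_def by simp
    ultimately show ?thesis using succ[of z] by auto
  qed
  have "succ_in qs x = hd (A @ y # B @ [x])" "succ_in qs y = hd (B @ x # A @ [y])"
    using succ_in_split[of x "[]" "A @ y # B"] succ_in_split[of y "x # A" B] d by (auto simp: qs_def)
  then have s: "succ_in ps x = hd (A @ [y])" "succ_in ps y = hd (B @ [x])"
    using succ assms(2,3) by (cases A; cases B; simp)+
  have c: "cycle_edges qs = cycle_edges ps" unfolding qs ps by (rule cycle_edges_rotate)
  show thesis using that[of A B] d set c s A B unfolding qs_def by blast
qed

lemma cycle_successor:
  assumes "distinct ps" "3 \<le> length ps"
  shows "bij_betw (succ_in ps) (set ps) (set ps)"
    "\<And>x. x \<in> set ps \<Longrightarrow> succ_in ps x \<noteq> x" "\<And>x. x \<in> set ps \<Longrightarrow> succ_in ps (succ_in ps x) \<noteq> x"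
    "cycle_edges ps = {{x, succ_in ps x} | x. x \<in> set ps}"
proof -
  \<comment> \<open>Rotated to start at \<open>x\<close>, a list of length at least three displays
    \<open>x\<close> and its next two successors as distinct entries.\<close>
  have step: "\<exists>y z R. distinct (x # y # z # R) \<and> set (x # y # z # R) = set ps \<and>
      succ_in ps x = y \<and> succ_in ps y = z" if x: "x \<in> set ps" for x
  proof -
    obtain U W where ps: "ps = U @ x # W" using x by (meson split_list)
    have "length (W @ U) \<ge> 2" using assms ps by simp
    then obtain y z R where R: "W @ U = y # z # R"
      by (cases "W @ U"; cases "tl (W @ U)") auto
    have qs: "x # y # z # R = (x # W) @ U" using R by simp
    have d: "distinct (x # y # z # R)" and set: "set (x # y # z # R) = set ps"
      using assms(1) unfolding qs ps by auto
    have succ: "succ_in ps w = succ_in (x # y # z # R) w" if "w \<in> set ps" for w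
      using succ_in_rotate[of U "x # W" w] that assms(1) unfolding qs ps by auto
    have "succ_in (x # y # z # R) x = y" "succ_in (x # y # z # R) y = z"
      using succ_in_split[of x "[]" "y # z # R"] succ_in_split[of y "[x]" "z # R"] d by auto
    moreover have "y \<in> set ps" using set by auto
    ultimately show ?thesis using d set succ x by metis
  qed
  show neq: "succ_in ps x \<noteq> x" if "x \<in> set ps" for x using step[OF that] by auto
  show "succ_in ps (succ_in ps x) \<noteq> x" if "x \<in> set ps" for x using step[OF that] by auto
  have into: "succ_in ps x \<in> set ps" if "x \<in> set ps" for x using step[OF that] by auto
  have "ps \<noteq> []" using assms by auto
  have last: "succ_in ps (last ps) = hd ps"
  proof -
    have ps: "ps = butlast ps @ [last ps]" using \<open>ps \<noteq> []\<close> by simp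
    moreover have "last ps \<notin> set (butlast ps)"
      using assms(1) ps by (metis distinct_append disjoint_iff list.set_intros(1))
    ultimately have "succ_in ps (last ps) = hd (butlast ps @ [last ps])"
      using succ_in_split[of "last ps" "butlast ps" "[]"] by simp
    then show ?thesis using ps by simp
  qed
  have nth: "succ_in ps (ps ! i) = ps ! Suc i" if "Suc i < length ps" for i
  proof -
    have ps: "ps = take i ps @ ps ! i # drop (Suc i) ps" using that by (simp add: id_take_nth_drop)
    have "ps ! i \<notin> set (take i ps)" using assms(1) that ps
      by (metis Suc_lessD disjoint_iff distinct_append list.set_intros(1))
    then have "succ_in ps (ps ! i) = hd (drop (Suc i) ps @ take i ps @ [ps ! i])"
      using succ_in_split[of "ps ! i" "take i ps" "drop (Suc i) ps"] ps by simp
    then show ?thesis using that by (simp add: hd_append hd_drop_conv_nth)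
  qed
  have mem: "x = last ps \<or> (\<exists>i. Suc i < length ps \<and> x = ps ! i)" if x: "x \<in> set ps" for x
  proof -
    obtain i where "i < length ps \<and> ps ! i = x" using x unfolding in_set_conv_nth by blast
    then have i: "i < length ps" "x = ps ! i" by simp_all
    show ?thesis
    proof (cases "Suc i < length ps")
      case False
      then have "i = length ps - 1" using i by simp
      then show ?thesis using i \<open>ps \<noteq> []\<close> by (simp add: last_conv_nth)
    qed (use i in blast)
  qed
  show edges: "cycle_edges ps = {{x, succ_in ps x} | x. x \<in> set ps}"
  proof
    show "cycle_edges ps \<subseteq> {{x, succ_in ps x} | x. x \<in> set ps}"
    proof
      fix e assume "e \<in> cycle_edges ps"
      then consider "e = {last ps, hd ps}" | i where "Suc i < length ps" "e = {ps ! i, ps ! Suc i}"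
        by (auto simp: cycle_edges_def path_edges_def)
      then show "e \<in> {{x, succ_in ps x} | x. x \<in> set ps}"
      proof cases
        case 1
        then show ?thesis using last \<open>ps \<noteq> []\<close> by (auto intro!: exI[of _ "last ps"])
      next
        case (2 i)
        then show ?thesis using nth[of i] by (auto intro!: exI[of _ "ps ! i"])
      qed
    qed
    show "{{x, succ_in ps x} | x. x \<in> set ps} \<subseteq> cycle_edges ps"
    proof
      fix e assume "e \<in> {{x, succ_in ps x} | x. x \<in> set ps}"
      then obtain x where x: "x \<in> set ps" "e = {x, succ_in ps x}" by auto
      from mem[OF x(1)] show "e \<in> cycle_edges ps"
      proof
        assume "x = last ps"
        then show ?thesis using x last by (simp add: cycle_edges_def)
      next
        assume "\<exists>i. Suc i < length ps \<and> x = ps ! i"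
        then show ?thesis using x nth by (auto simp: cycle_edges_def path_edges_def)
      qed
    qed
  qed
  have "set ps \<subseteq> succ_in ps ` set ps"
  proof
    fix y assume "y \<in> set ps"
    then obtain i where "i < length ps \<and> ps ! i = y" unfolding in_set_conv_nth by blast
    then have i: "i < length ps" "y = ps ! i" by simp_all
    show "y \<in> succ_in ps ` set ps"
    proof (cases i)
      case 0
      then have "y = succ_in ps (last ps)" using i last \<open>ps \<noteq> []\<close> by (simp add: hd_conv_nth)
      then show ?thesis using \<open>ps \<noteq> []\<close> by simp
    next
      case (Suc j)
      then have "y = succ_in ps (ps ! j)" using i nth by simp
      then show ?thesis using i Suc by simp
    qed
  qed
  then have "succ_in ps ` set ps = set ps" using into by auto
  then show "bij_betw (succ_in ps) (set ps) (set ps)"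
    by (simp add: bij_betw_def eq_card_imp_inj_on)
qed

text \<open>An inner vertex of a path has two different neighbors on it. A leaf has only its parent
  as tree neighbor. The children of \<open>par a\<close> are all leaves, so on the path they could
  only be its ends, whose parents are different from \<open>par a\<close>; only one neighbor of
  \<open>par a\<close> remains.\<close>

lemma leaf_path_avoids:
  assumes E: "edges T = {{x, par x} | x. x \<in> V - {r}}"
    and childless: "\<And>x y. x \<in> S \<Longrightarrow> y \<in> V - {r} \<Longrightarrow> par y \<noteq> x"
    and sibling: "\<And>x y. x \<in> S \<Longrightarrow> y \<in> V - {r} \<Longrightarrow> par y = par x \<Longrightarrow> y \<in> S"
    and par_neq: "\<And>x. x \<in> V - {r} \<Longrightarrow> par x \<noteq> x"
    and S: "S \<subseteq> V - {r}"
    and q: "path_in T q" "hd q \<in> S" "last q \<in> S"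
    and a: "a \<in> S" "par (hd q) \<noteq> par a" "par (last q) \<noteq> par a"
  shows "set q \<inter> S = {hd q, last q} \<and> par a \<notin> set q"
proof -
  have "q \<noteq> []" and dist: "distinct q" using q by (auto simp: path_in_def)
  have inner: "\<exists>u w. u \<in> set q \<and> w \<in> set q \<and> u \<noteq> w \<and> {u, z} \<in> edges T \<and> {z, w} \<in> edges T"
    if z: "z \<in> set q" "z \<noteq> hd q" "z \<noteq> last q" for z
  proof -
    obtain A B where AB: "q = A @ z # B" using z(1) by (meson split_list)
    have "A \<noteq> []" "B \<noteq> []" using z AB by auto
    then obtain A' u w B' where AB': "A = A' @ [u]" "B = w # B'" by (metis append_butlast_last_id list.exhaust)
    have "q = (A' @ [u]) @ (z # w # B')" using AB AB' by simp
    then have "{u, z} \<in> path_edges q" "{z, w} \<in> path_edges q"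
      using path_edges_append[of "A' @ [u]" "z # w # B'"] by auto
    moreover have "path_edges q \<subseteq> edges T" using q(1) by (simp add: path_in_def)
    moreover have "u \<noteq> w" using dist AB AB' by auto
    ultimately show ?thesis using AB AB' by (intro exI[of _ u] exI[of _ w]) auto
  qed
  have nbr: "w = par z \<or> w \<in> V - {r} \<and> par w = z" if "{z, w} \<in> edges T" for z w
    using that unfolding E by (auto simp: doubleton_eq_iff)
  have S_q: "set q \<inter> S = {hd q, last q}"
  proof
    show "{hd q, last q} \<subseteq> set q \<inter> S" using q \<open>q \<noteq> []\<close> by auto
    show "set q \<inter> S \<subseteq> {hd q, last q}"
    proof
      fix z assume z: "z \<in> set q \<inter> S"
      show "z \<in> {hd q, last q}"
      proof (rule ccontr)
        assume "z \<notin> {hd q, last q}"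
        then obtain u w where uw: "u \<noteq> w" "{z, u} \<in> edges T" "{z, w} \<in> edges T"
          using inner[of z] z by (auto simp: insert_commute)
        have "u = par z" using nbr[OF uw(2)] childless[of z u] z by auto
        moreover have "w = par z" using nbr[OF uw(3)] childless[of z w] z by auto
        ultimately show False using uw by simp
      qed
    qed
  qed
  moreover have "par a \<notin> set q"
  proof
    assume v: "par a \<in> set q"
    have "par a \<notin> S" using childless[of "par a" a] a S by auto
    then have "par a \<noteq> hd q" "par a \<noteq> last q" using q(2,3) by metis+
    from inner[OF v this] obtain u w
      where uw: "u \<in> set q" "w \<in> set q" "u \<noteq> w" "{par a, u} \<in> edges T" "{par a, w} \<in> edges T"
      by (metis insert_commute)
    have no: "\<not> (x \<in> V - {r} \<and> par x = par a)" if "x \<in> set q" for x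
    proof
      assume x: "x \<in> V - {r} \<and> par x = par a"
      then have "x \<in> S" using sibling a by blast
      then have "x \<in> {hd q, last q}" using S_q that by blast
      then show False using x a by auto
    qed
    \<comment> \<open>If \<open>par a\<close> is the root, \<open>par (par a)\<close> is an
      arbitrary value; the contradiction only uses that \<open>u\<close> and \<open>w\<close> both
      equal it.\<close>
    have "u = par (par a)" using nbr[OF uw(4)] no[OF uw(1)] by auto
    moreover have "w = par (par a)" using nbr[OF uw(5)] no[OF uw(2)] by auto
    ultimately show False using uw by simp
  qed
  ultimately show ?thesis by blast
qed

text \<open>Every violation yields two leaves with a common parent and, on both arcs between them, a
  leaf with another parent. Two exits are separated by their successors, the leaves after two
  entering edges by their predecessors, and a block of one leaf is separated from a sibling
  elsewhere by its two neighbors.\<close>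

lemma leaf_cycle_blocks:
  fixes par :: "'a \<Rightarrow> 'a"
  assumes S: "set ps = S" "distinct ps" "3 \<le> length ps"
    and cross: "\<And>a c A B b d. \<lbrakk>set (a # A @ c # B) = S; distinct (a # A @ c # B);
        cycle_edges (a # A @ c # B) = cycle_edges ps; par a = par c;
        b \<in> set A; d \<in> set B; par b \<noteq> par a; par d \<noteq> par a\<rbrakk> \<Longrightarrow> False"
    and siblings: "\<And>x. x \<in> S \<Longrightarrow> \<exists>y\<in>S. y \<noteq> x \<and> par y = par x"
    and nx_def: "nx = succ_in ps"
  shows "(\<forall>x\<in>S. \<forall>y\<in>S. par (nx x) \<noteq> par x \<longrightarrow> par (nx y) \<noteq> par y \<longrightarrow> par x = par y \<longrightarrow> x = y) \<and>
    (\<forall>x\<in>S. \<forall>y\<in>S. par (nx x) \<noteq> par x \<longrightarrow> par (nx y) \<noteq> par y \<longrightarrow> par (nx x) = par (nx y) \<longrightarrow> x = y) \<and>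
    (\<forall>x\<in>S. par (nx x) \<noteq> par x \<longrightarrow> par (nx (nx x)) = par (nx x))"
proof (intro conjI ballI impI)
  have nx: "bij_betw nx S S" using cycle_successor(1)[OF S(2,3)] S(1) by (simp add: nx_def)
  have nx_in: "nx x \<in> S" if "x \<in> S" for x using nx that by (auto simp: bij_betw_def)
  show "x = y" if xy: "x \<in> S" "y \<in> S" "par (nx x) \<noteq> par x" "par (nx y) \<noteq> par y" "par x = par y" for x y
  proof (rule ccontr)
    assume "x \<noteq> y"
    then obtain A B where AB: "distinct (x # A @ y # B)" "set (x # A @ y # B) = set ps"
      "cycle_edges (x # A @ y # B) = cycle_edges ps" "nx x = hd (A @ [y])" "nx y = hd (B @ [x])"
      using cycle_split[OF S(2), of x y] xy S(1) unfolding nx_def by metis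
    have "nx x \<in> set A" using AB(4) xy by (cases A) auto
    moreover have "nx y \<in> set B" using AB(5) xy by (cases B) auto
    ultimately show False using cross[of x A y B "nx x" "nx y"] AB xy S(1) by simp
  qed
  show "x = y" if xy: "x \<in> S" "y \<in> S" "par (nx x) \<noteq> par x" "par (nx y) \<noteq> par y" "par (nx x) = par (nx y)" for x y
  proof (rule ccontr)
    assume "x \<noteq> y"
    then have "nx x \<noteq> nx y" using nx xy by (auto simp: bij_betw_def inj_on_def)
    then obtain A B where AB: "distinct (nx x # A @ nx y # B)" "set (nx x # A @ nx y # B) = set ps"
      "cycle_edges (nx x # A @ nx y # B) = cycle_edges ps"
      "\<And>z. z \<in> set A \<Longrightarrow> nx z \<noteq> nx x" "\<And>z. z \<in> set B \<Longrightarrow> nx z \<noteq> nx y"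
      using cycle_split[OF S(2), of "nx x" "nx y"] nx_in[OF xy(1)] nx_in[OF xy(2)] S(1) unfolding nx_def by metis
    have "x \<in> set (nx x # A @ nx y # B)" "y \<in> set (nx x # A @ nx y # B)" using AB(2) xy S(1) by simp_all
    then have "x \<in> set B" "y \<in> set A" using AB(4,5) xy by auto
    then show False using cross[of "nx x" A "nx y" B y x] AB(1-3) xy S(1) by simp
  qed
  show "par (nx (nx x)) = par (nx x)" if x: "x \<in> S" "par (nx x) \<noteq> par x" for x
  proof (rule ccontr)
    assume neq: "par (nx (nx x)) \<noteq> par (nx x)"
    obtain c where c: "c \<in> S" "c \<noteq> nx x" "par c = par (nx x)" using siblings[OF nx_in[OF x(1)]] by blast
    obtain A B where AB: "distinct (nx x # A @ c # B)" "set (nx x # A @ c # B) = set ps"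
      "cycle_edges (nx x # A @ c # B) = cycle_edges ps" "nx (nx x) = hd (A @ [c])"
      "\<And>z. z \<in> set A \<Longrightarrow> nx z \<noteq> nx x"
      using cycle_split[OF S(2), of "nx x" c] nx_in[OF x(1)] c S(1) unfolding nx_def by metis
    have "nx (nx x) \<in> set A" using AB(4) neq c by (cases A) auto
    moreover have "x \<in> set (nx x # A @ c # B)" using AB(2) x S(1) by simp
    then have "x \<in> set B" using AB(5) x c by auto
    ultimately show False using cross[of "nx x" A c B "nx (nx x)" x] AB(1-3) x c neq S(1) by simp
  qed
qed


section \<open>Complete Halin graphs\<close>

lemma graph_dist_self: "u \<in> verts G \<Longrightarrow> graph_dist G u u = 0"
  using graph_dist_le[of G "[u]" u u] by (auto simp: path_in_def)

text \<open>Naming edges by their lower ends is injective: two names of one edge would each be the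
  parent of the other, against the depths.\<close>

lemma deg_eq_card_children:
  assumes E: "edges T = {{x, par x} | x. x \<in> V - {r}}"
    and dep: "\<And>x. x \<in> V - {r} \<Longrightarrow> dep x = Suc (dep (par x))"
    and "finite V" "v \<in> V"
  shows "deg T v = card ({x \<in> V - {r}. par x = v} \<union> ({v} - {r}))"
proof -
  let ?I = "{x \<in> V - {r}. par x = v} \<union> ({v} - {r})"
  have "{e \<in> edges T. v \<in> e} = (\<lambda>x. {x, par x}) ` ?I"
    using assms(4) unfolding E by auto
  moreover have "inj_on (\<lambda>x. {x, par x}) ?I"
  proof (rule inj_onI)
    fix x y assume "x \<in> ?I" "y \<in> ?I" "{x, par x} = {y, par y}"
    then show "x = y" using dep[of x] dep[of y] assms(4) by (auto simp: doubleton_eq_iff)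
  qed
  ultimately show ?thesis unfolding deg_def by (simp add: card_image)
qed

lemma complete_halin_choosable:
  fixes H T C :: "'a ugraph"
  assumes "complete_halin_graph H T C"
  shows "star_edge_choosable H (max ((theta T + max_deg T) div 2) (2 * (max_deg T div 2) + 6))"
proof -
  define k where "k = max ((theta T + max_deg T) div 2) (2 * (max_deg T div 2) + 6)"
  define V where "V = verts T"
  define S where "S = leaves T"
  obtain r d where r: "r \<in> V" and d: "\<And>v. v \<in> S \<Longrightarrow> graph_dist T r v = d"
    using assms unfolding complete_halin_graph_def V_def S_def by blast
  have halin: "tree T" "\<forall>v\<in>verts T. deg T v \<noteq> 2" "cycle_graph C" "verts C = S"
      "simple_graph H" "H = graph_union T C"
    using assms by (auto simp: complete_halin_graph_def halin_graph_def S_def)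
  obtain pos \<gamma> where emb: "plane_embedding H pos \<gamma>"
    and front: "frontier (outside (drawing pos \<gamma> H)) = drawing pos \<gamma> C"
    using assms unfolding complete_halin_graph_def halin_graph_def by blast
  have simple: "simple_graph T" and con: "connected_graph T" using halin(1) by (auto simp: tree_def)
  have finV: "finite V" using simple by (simp add: simple_graph_def V_def)
  define dep where "dep = graph_dist T r"
  obtain par where par_in: "\<And>x. x \<in> V - {r} \<Longrightarrow> par x \<in> V"
    and dep_par: "\<And>x. x \<in> V - {r} \<Longrightarrow> dep x = Suc (dep (par x))"
    and ET: "edges T = {{x, par x} | x. x \<in> V - {r}}"
    unfolding V_def dep_def by (fact tree_parent[OF halin(1) r[unfolded V_def]])
  have dep_r: "dep r = 0" using graph_dist_self r by (simp add: dep_def V_def)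
  have par_neq: "par x \<noteq> x" if "x \<in> V - {r}" for x using dep_par[OF that] by (metis n_not_Suc_n)
  obtain ps where ps: "cycle_in C ps" "S = set ps" "edges C = cycle_edges ps"
    using halin(3,4) by (auto simp: cycle_graph_def)
  then have dist: "distinct ps" and len: "3 \<le> length ps" by (auto simp: cycle_in_def)
  have SV: "S \<subseteq> V" by (auto simp: S_def V_def leaves_def)
  have "card S = length ps" using ps dist by (simp add: distinct_card)
  \<comment> \<open>With a leaf as root the common distance would be 0 and the root the only
    leaf.\<close>
  have r_leaf: "r \<notin> S"
  proof
    assume "r \<in> S"
    then have "dep x = 0" if "x \<in> S" for x using d that dep_r unfolding dep_def by metis
    then have "S \<subseteq> {r}" using dep_par SV by fastforce
    then have "card S \<le> card {r}" by (intro card_mono) auto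
    then show False using \<open>card S = length ps\<close> len by simp
  qed
  then have S_sub: "S \<subseteq> V - {r}" using SV by auto
  define kids where "kids v = {x \<in> V - {r}. par x = v}" for v
  have fin_ch: "finite (kids v)" for v using finV by (simp add: kids_def)
  have self_ch: "v \<notin> kids v" for v using par_neq[of v] by (auto simp: kids_def)
  have deg: "deg T v = card (kids v \<union> ({v} - {r}))" if "v \<in> V" for v
    using deg_eq_card_children[where T = T and V = V and r = r and par = par and dep = dep, OF ET dep_par finV that]
    by (simp add: kids_def)
  then have deg': "deg T v = card (kids v) + of_bool (v \<noteq> r)" if "v \<in> V" for v
    using that fin_ch self_ch by simp
  have leaf_iff: "v \<in> S \<longleftrightarrow> kids v = {}" if "v \<in> V - {r}" for v
    using deg'[of v] that fin_ch[of v] by (auto simp: S_def leaves_def V_def)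
  have childless: "par y \<noteq> x" if "x \<in> S" "y \<in> V - {r}" for x y
    using leaf_iff[of x] that S_sub by (auto simp: kids_def)
  \<comment> \<open>A deepest vertex has no child and is different from the root, so it is a leaf
    and lies at the common depth.\<close>
  have dep_le: "dep x \<le> d" if "x \<in> V" for x
  proof -
    have "finite (dep ` V)" "dep ` V \<noteq> {}" using finV that by auto
    then have "Max (dep ` V) \<in> dep ` V" by (rule Max_in)
    then obtain m where m: "m \<in> V" "dep m = Max (dep ` V)" by auto
    have max: "dep y \<le> dep m" if "y \<in> V" for y using m finV that by simp
    have "kids m = {}"
    proof (rule ccontr)
      assume "kids m \<noteq> {}"
      then obtain y where "y \<in> V - {r}" "par y = m" by (auto simp: kids_def)
      then show False using dep_par[of y] max[of y] by simp
    qed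
    moreover have "m \<noteq> r"
    proof
      assume "m = r"
      moreover obtain s where "s \<in> S" using ps(2) len by (cases ps) auto
      ultimately show False using max[of s] dep_par[of s] S_sub dep_r by auto
    qed
    ultimately have "m \<in> S" using leaf_iff m by simp
    then show ?thesis using d max[OF that] by (simp add: dep_def)
  qed
  \<comment> \<open>A sibling of a leaf has the maximal depth \<open>d\<close>, so a child of it
    would lie too deep.\<close>
  have sibling: "y \<in> S" if "x \<in> S" "y \<in> V - {r}" "par y = par x" for x y
  proof (rule ccontr)
    assume "y \<notin> S"
    then have "kids y \<noteq> {}" using leaf_iff[OF that(2)] by simp
    then obtain z where z: "z \<in> V - {r}" "par z = y" by (auto simp: kids_def)
    have "x \<in> V - {r}" using that S_sub by auto
    then have "dep y = dep x" using dep_par[of x] dep_par[OF that(2)] that(3) by simp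
    then have "dep y = d" using d[OF that(1)] by (simp add: dep_def)
    then show False using z dep_par[of z] dep_le[of z] by simp
  qed
  have parS: "par a \<in> V" "par a \<notin> S" if "a \<in> S" for a
  proof -
    have a: "a \<in> V - {r}" using that S_sub by auto
    then show "par a \<in> V" by (rule par_in)
    show "par a \<notin> S" using childless a by blast
  qed
  have deg3: "3 \<le> deg T (par a)" if "a \<in> S" for a
  proof -
    have "a \<in> kids (par a)" using that S_sub by (auto simp: kids_def)
    then have "deg T (par a) \<noteq> 0" using deg'[OF parS(1)[OF that]] fin_ch[of "par a"] by auto
    moreover have "deg T (par a) \<noteq> 1" using parS[OF that] by (simp add: S_def leaves_def V_def)
    moreover have "deg T (par a) \<noteq> 2" using halin(2) parS(1)[OF that] by (simp add: V_def)
    ultimately show ?thesis by linarith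
  qed
  \<comment> \<open>The parent of a leaf has degree at least three, since degree two is forbidden;
    even without its upper edge at least two children remain, and all of them are leaves.\<close>
  have siblings: "\<exists>y\<in>S. y \<noteq> x \<and> par y = par x" if x: "x \<in> S" for x
  proof -
    have "2 \<le> card (kids (par x))" using deg3[OF x] deg'[OF parS(1)[OF x]] by (simp add: of_bool_def split: if_splits)
    then have "\<not> kids (par x) \<subseteq> {x}" using card_mono[of "{x}" "kids (par x)"] by auto
    then obtain y where "y \<in> kids (par x)" "y \<noteq> x" by auto
    then show ?thesis using sibling[OF x, of y] by (auto simp: kids_def)
  qed
  have EH: "edges H = edges T \<union> edges C" "verts H = V \<union> S"
    using halin(4,6) by (simp_all add: graph_union_def V_def)
  have disj: "edges T \<inter> edges C = {}"
  proof -
    have "e \<subseteq> S" if "e \<in> edges C" for e using that cycle_successor(1,4)[OF dist len] ps by (auto simp: bij_betw_def)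
    moreover have "\<not> e \<subseteq> S" if "e \<in> edges T" for e using that childless unfolding ET by auto
    ultimately show ?thesis by blast
  qed
  have cross: False if cyc: "set (a # A @ c # B) = S" "distinct (a # A @ c # B)"
      "cycle_edges (a # A @ c # B) = cycle_edges ps" and v: "par a = par c"
      and b: "b \<in> set A" "par b \<noteq> par a" and e: "e \<in> set B" "par e \<noteq> par a" for a c A B b e
  proof -
    have S: "a \<in> S" "c \<in> S" "b \<in> S" "e \<in> S" using cyc b e by auto
    then obtain q where q: "path_in T q" "hd q = b" "last q = e"
      using con SV unfolding connected_graph_def V_def by blast
    have avoid: "set q \<inter> S = {hd q, last q} \<and> par a \<notin> set q"
    proof (rule leaf_path_avoids[OF ET], goal_cases)
      case (1 x y) then show ?case by (rule childless)
    next
      case (2 x y) then show ?case by (rule sibling)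
    next
      case (3 x) then show ?case by (rule par_neq)
    qed (use S_sub S q b e in auto)
    have qH: "path_in H q" using q(1) EH by (auto simp: path_in_def V_def)
    have qC: "path_edges q \<inter> edges C = {}" using q(1) disj by (auto simp: path_in_def)
    have avH: "{a, par a} \<in> edges H" "{par a, c} \<in> edges H"
      using S S_sub v unfolding EH ET by (auto simp: insert_commute)
    have vH: "par a \<in> verts H - verts C" using parS[OF S(1)] EH halin(4) by simp
    have CH: "edges C \<subseteq> edges H" "verts C \<subseteq> verts H" using EH halin(4) by auto
    have vC: "verts C = set (a # A @ c # B)" using halin(4) cyc(1) by simp
    have eC: "edges C = cycle_edges (a # A @ c # B)" using ps(3) cyc(3) by simp
    have qS: "set q \<inter> verts C = {b, e}" using avoid q halin(4) by simp
    show False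
      by (rule outer_cycle_noncrossing[OF emb halin(5) front CH vC eC cyc(2) refl b(1) e(1) vH avH qH q(2,3)
        qS conjunct2[OF avoid] qC])
  qed
  define nx where "nx = succ_in ps"
  note succ = cycle_successor[OF dist len, folded nx_def ps(2)]
  have "(\<forall>x\<in>S. \<forall>y\<in>S. par (nx x) \<noteq> par x \<longrightarrow> par (nx y) \<noteq> par y \<longrightarrow> par x = par y \<longrightarrow> x = y) \<and>
    (\<forall>x\<in>S. \<forall>y\<in>S. par (nx x) \<noteq> par x \<longrightarrow> par (nx y) \<noteq> par y \<longrightarrow> par (nx x) = par (nx y) \<longrightarrow> x = y) \<and>
    (\<forall>x\<in>S. par (nx x) \<noteq> par x \<longrightarrow> par (nx (nx x)) = par (nx x))"
  proof (rule leaf_cycle_blocks[OF ps(2)[symmetric] dist len _ _ nx_def], goal_cases)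
    case (1 a c A B b e)
    show ?case by (rule cross[OF 1(1-4) 1(5,7) 1(6,8)])
  next
    case (2 x)
    then show ?case by (rule siblings)
  qed
  then have blocks:
    "\<forall>x\<in>S. \<forall>y\<in>S. par (nx x) \<noteq> par x \<longrightarrow> par (nx y) \<noteq> par y \<longrightarrow> par x = par y \<longrightarrow> x = y"
    "\<forall>x\<in>S. \<forall>y\<in>S. par (nx x) \<noteq> par x \<longrightarrow> par (nx y) \<noteq> par y \<longrightarrow> par (nx x) = par (nx y) \<longrightarrow> x = y"
    "\<forall>x\<in>S. par (nx x) \<noteq> par x \<longrightarrow> par (nx (nx x)) = par (nx x)"
    by blast+
  interpret rooted_tree_cycle V r par dep S nx
  proof (unfold_locales, goal_cases)
    case 1 show ?case by (rule finV)
  next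
    case (2 x) then show ?case by (rule par_in)
  next
    case 3 show ?case by (rule dep_r)
  next
    case (4 x) then show ?case by (rule dep_par)
  next
    case 5 show ?case by (rule S_sub)
  next
    case (6 x y) then show ?case by (rule childless)
  next
    case (7 x y) then show ?case by (rule sibling)
  next
    case (8 x y) then show ?case using d by (simp add: dep_def)
  next
    case 9 show ?case by (rule succ(1))
  next
    case (10 x) then show ?case by (rule succ(2))
  next
    case (11 x) then show ?case by (rule succ(3))
  next
    case (12 x y) then show ?case using blocks(1) by blast
  next
    case (13 x y) then show ?case using blocks(2) by blast
  next
    case (14 x) then show ?case using blocks(3) by blast
  qed
  have card_Inc_deg: "card (Inc v) = deg T v" if "v \<in> V" for v
    using deg[OF that] unfolding Inc_def by (simp add: ch_def kids_def)
  have deg_le: "deg T v \<le> max_deg T" if "v \<in> V" for v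
    unfolding max_deg_def using that finV by (intro Max_ge) (auto simp: V_def)
  have theta_ge: "deg T x + deg T (par x) \<le> theta T" if "x \<in> V - {r}" for x
  proof -
    have sub: "{deg T x + deg T y | x y. {x, y} \<in> edges T} \<subseteq> (\<lambda>(x, y). deg T x + deg T y) ` (V \<times> V)"
      using simple by (force simp: simple_graph_def V_def)
    have "finite {deg T x + deg T y | x y. {x, y} \<in> edges T}"
      by (rule finite_subset[OF sub]) (use finV in simp)
    moreover have "{x, par x} \<in> edges T" using that unfolding ET by blast
    ultimately show ?thesis unfolding theta_def by (intro Max_ge) auto
  qed
  have k: "(theta T + max_deg T) div 2 \<le> k" "2 * (max_deg T div 2) + 6 \<le> k" by (simp_all add: k_def)
  obtain s where "s \<in> S" using ps(2) len by (cases ps) auto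
  then have "3 \<le> max_deg T" using deg3 deg_le parS(1) by (meson le_trans)
  \<comment> \<open>For \<open>k_edge\<close>, twice the left-hand side is at most the two degrees
    plus one of them again, hence at most \<open>theta T + max_deg T\<close>. The other bounds come
    from \<open>2 * (max_deg T div 2) + 6\<close>, which is 8 for maximum degree three and at least
    10 from four on.\<close>
  interpret rooted_tree_cycle_bound V r par dep S nx k
  proof
    fix x assume x: "x \<in> V - {r}"
    have "deg T x \<le> max_deg T" "deg T (par x) \<le> max_deg T" using deg_le x par_in by auto
    then show "card (Inc x) + card (Inc (par x)) div 2 \<le> k" "card (Inc (par x)) + card (Inc x) div 2 \<le> k"
      using k(1) theta_ge[OF x] card_Inc_deg[of x] card_Inc_deg[of "par x"] x par_in[OF x] by auto
  next
    fix x assume "x \<in> V"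
    then show "card (Inc x) + 5 \<le> k" using deg_le[of x] card_Inc_deg[of x] k(2) by simp
    assume "4 \<le> card (Inc x)"
    then have "4 \<le> max_deg T" using deg_le[of x] card_Inc_deg[of x] \<open>x \<in> V\<close> by simp
    then show "10 \<le> k" using k(2) div_le_mono[of 4 "max_deg T" 2] by simp
  next
    show "8 \<le> k" using k(2) div_le_mono[OF \<open>3 \<le> max_deg T\<close>, of 2] by simp
  qed
  have "edges H = {{x, par x} | x. x \<in> V - {r}} \<union> {{x, nx x} | x. x \<in> S}"
    using EH(1) ET ps(3) succ(4) by simp
  then have "star_edge_choosable H k" using halin(5) by (intro star_edge_choosable_if_edges)
  then show ?thesis by (simp add: k_def)
qed

theorem theorem13:
  fixes H T C :: "'a ugraph"
  assumes "complete_halin_graph H T C"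
    and "card (edges C) \<noteq> 5"
  shows "list_star_chromatic_index H
           \<le> max ((theta T + max_deg T) div 2) (2 * (max_deg T div 2) + 6)"
  unfolding list_star_chromatic_index_def
  by (rule Least_le) (rule complete_halin_choosable[OF assms(1)])

end
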